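(* (i) Almost all $3$-uniform hypergraphs are weakly $2$-weighted but not weakly $1$-weighted. (ii) For every $r\ge 4$, almost all $r$-uniform hypergraphs are weakly $1$-weighted.
   Context: An $r$-uniform hypergraph $H=(V,E)$ has every edge of size $r$. Given $\omega:E\to\{1,\dots,w\}$, the induced vertex-coloring is $c(v)=\sum_{e\ni v}\omega(e)$. The coloring is weak if no edge is monochromatic. $H$ is weakly $w$-weighted if some $\omega:E\to\{1,\dots,w\}$ induces a weak coloring. "Almost all $r$-uniform hypergraphs on $n$ vertices have property $\mathcal P$" means that the number of $r$-uniform hypergraphs on vertex set $[n]$ without $\mathcal P$ is $o\big(2^{\binom{n}{r}}\big)$ as $n\to\infty$. *)

theory Defs
  imports Complex_Main "HOL-Library.Landau_Symbols"
begin

definition uniform_hypergraphs :: "nat \<Rightarrow> nat \<Rightarrow> nat set set set" where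
  "uniform_hypergraphs r n = Pow {e. e \<subseteq> {1..n} \<and> card e = r}"

definition induced_colour :: "nat set set \<Rightarrow> (nat set \<Rightarrow> nat) \<Rightarrow> nat \<Rightarrow> nat" where
  "induced_colour E \<omega> v = (\<Sum>e\<in>{e\<in>E. v \<in> e}. \<omega> e)"

definition weakly_weighted :: "nat set set \<Rightarrow> nat \<Rightarrow> bool" where
  "weakly_weighted E w \<longleftrightarrow>
     (\<exists>\<omega>. (\<forall>e\<in>E. \<omega> e \<in> {1..w}) \<and>
          (\<forall>e\<in>E. \<exists>u\<in>e. \<exists>v\<in>e. induced_colour E \<omega> u \<noteq> induced_colour E \<omega> v))"

definition almost_all :: "nat \<Rightarrow> (nat set set \<Rightarrow> bool) \<Rightarrow> bool" where
  "almost_all r P \<longleftrightarrow>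
     (\<lambda>n. real (card {E \<in> uniform_hypergraphs r n. \<not> P E}))
       \<in> o(\<lambda>n. 2 ^ (n choose r))"

end

theory Submission
  imports Defs "HOL-Real_Asymp.Real_Asymp" "HOL-Library.Disjoint_Sets"
begin

text \<open>
  Each assertion bounds the probability that a uniformly random subset of the set of all
  \<open>r\<close>-subsets of \<open>{1..n}\<close> is bad.

  Collisions: condition on everything except, for each vertex \<open>v\<close> of \<open>S\<close> but one, a block of \<open>M\<close>
  equally weighted edges meeting \<open>S\<close> in \<open>v\<close> alone. The colours then coincide on \<open>S\<close> only if
  \<open>card S - 1\<close> independent binomial variables take prescribed values, which has probability at most
  \<open>M powr (- (card S - 1) / 2)\<close>. For \<open>r \<ge> 4\<close> and constant weights, \<open>M\<close> has order \<open>n ^ (r - 1)\<close>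
  and the union bound over all \<open>S\<close> suffices, since \<open>(r - 1)\<^sup>2 / 2 > r\<close>.

  For \<open>r = 3\<close> and weights in \<open>{1, 2}\<close>, give weight 2 to the triples with large vertex sum. The expected
  colours of \<open>i\<close> and \<open>j\<close> then differ by at least \<open>\<bar>i - j\<bar> n / 16\<close>, so Chernoff's bound separates all
  pairs at distance at least \<open>n powr (1 / 4)\<close>, and only \<open>O(n powr (3 / 2))\<close> triples remain, for each
  of which the collision bound is \<open>O(1 / n\<^sup>2)\<close>.

  For \<open>r = 3\<close> and constant weights, reserve about \<open>K = log 2 n / 6\<close> edges at almost every vertex such
  that the reserved edges of different vertices are different, and reveal the others first. Most degrees
  lie in a window of width \<open>O(n)\<close>, so by pigeonhole linearly many disjoint revealed edges have degrees
  within \<open>K\<close> of each other. The reserved edges equalise the degrees of each of these edges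
  independently with probability at least \<open>2 powr (- 3 * K) \<ge> n powr (- 1 / 2)\<close>.
\<close>

section \<open>Uniformly random subsets of a finite set\<close>

text \<open>Expectation over a random subset of \<open>X\<close> that keeps every element
  independently with probability 1/2; \<open>dens\<close> is the corresponding probability.\<close>

definition avg :: "'a set \<Rightarrow> ('a set \<Rightarrow> real) \<Rightarrow> real" where
  "avg X f = (\<Sum>E\<in>Pow X. f E) / 2 ^ card X"

definition dens :: "'a set \<Rightarrow> ('a set \<Rightarrow> bool) \<Rightarrow> real" where
  "dens X P = avg X (\<lambda>E. of_bool (P E))"

lemma avg_const: "finite X \<Longrightarrow> avg X (\<lambda>E. c) = c"
  by (simp add: avg_def card_Pow)

lemma avg_mono: "(\<And>E. E \<subseteq> X \<Longrightarrow> f E \<le> g E) \<Longrightarrow> avg X f \<le> avg X g"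
  unfolding avg_def by (intro divide_right_mono sum_mono) auto

lemma avg_cong: "(\<And>E. E \<subseteq> X \<Longrightarrow> f E = g E) \<Longrightarrow> avg X f = avg X g"
  unfolding avg_def by (intro arg_cong2[where f = "(/)"] sum.cong) auto

lemma avg_sum: "avg X (\<lambda>E. \<Sum>i\<in>I. f i E) = (\<Sum>i\<in>I. avg X (f i))"
  unfolding avg_def sum_divide_distrib[symmetric] by (subst sum.swap) simp

lemma avg_cmult: "avg X (\<lambda>E. c * f E) = c * avg X f"
  unfolding avg_def by (simp add: sum_distrib_left)

lemma avg_mult_right: "avg X (\<lambda>E. f E * c) = avg X f * c"
  unfolding avg_def by (simp add: sum_distrib_right)

lemma avg_add: "avg X (\<lambda>E. f E + g E) = avg X f + avg X g"
  unfolding avg_def by (simp add: sum.distrib add_divide_distrib)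

lemma avg_le_const: "finite X \<Longrightarrow> (\<And>E. E \<subseteq> X \<Longrightarrow> f E \<le> c) \<Longrightarrow> avg X f \<le> c"
  using avg_mono[of X f "\<lambda>_. c"] by (simp add: avg_const)

lemma avg_nonneg: "(\<And>E. E \<subseteq> X \<Longrightarrow> 0 \<le> f E) \<Longrightarrow> 0 \<le> avg X f"
  unfolding avg_def by (intro divide_nonneg_nonneg sum_nonneg) auto

text \<open>Fubini's theorem: a subset of a disjoint union is a unique pair of subsets, so the two
  parts are independent and can be revealed one after the other.\<close>

lemma avg_Un:
  assumes "finite A" "finite B" "A \<inter> B = {}"
  shows "avg (A \<union> B) f = avg A (\<lambda>S. avg B (\<lambda>T. f (S \<union> T)))"
proof -
  have "bij_betw (\<lambda>(S, T). S \<union> T) (Pow A \<times> Pow B) (Pow (A \<union> B))"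
    using assms(3) by (intro bij_betw_byWitness[where f' = "\<lambda>E. (E \<inter> A, E \<inter> B)"]) auto
  then have "(\<Sum>E\<in>Pow (A \<union> B). f E) = (\<Sum>(S, T)\<in>Pow A \<times> Pow B. f (S \<union> T))"
    by (subst sum.reindex_bij_betw[symmetric]) (auto simp: case_prod_unfold)
  also have "\<dots> = (\<Sum>S\<in>Pow A. \<Sum>T\<in>Pow B. f (S \<union> T))"
    by (simp add: sum.cartesian_product)
  finally show ?thesis
    using assms by (simp add: avg_def card_Un_disjoint power_add sum_divide_distrib[symmetric] field_simps)
qed

lemma avg_split:
  assumes "finite X" "B \<subseteq> X"
  shows "avg X f = avg (X - B) (\<lambda>S. avg B (\<lambda>T. f (S \<union> T)))"
proof -
  have "(X - B) \<inter> B = {}" "X - B \<union> B = X" using assms(2) by auto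
  then show ?thesis
    using avg_Un[of "X - B" B f] assms finite_subset[OF assms(2,1)] by simp
qed

text \<open>Independence of disjoint blocks, obtained by peeling off one block at a time with
  \<open>avg_Un\<close>.\<close>

lemma avg_prod:
  assumes "finite I" "\<And>i. i \<in> I \<Longrightarrow> finite (B i)" "disjoint_family_on B I"
  shows "avg (\<Union>i\<in>I. B i) (\<lambda>E. \<Prod>i\<in>I. f i (E \<inter> B i)) = (\<Prod>i\<in>I. avg (B i) (f i))"
  using assms
proof (induction I rule: finite_induct)
  case empty
  then show ?case by (simp add: avg_def)
next
  case (insert i I)
  have disj: "B i \<inter> (\<Union>j\<in>I. B j) = {}"
    using insert.prems(2) insert.hyps(2) by (fastforce simp: disjoint_family_on_def)
  have IH: "avg (\<Union>i\<in>I. B i) (\<lambda>E. \<Prod>i\<in>I. f i (E \<inter> B i)) = (\<Prod>i\<in>I. avg (B i) (f i))"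
    using insert by (auto simp: disjoint_family_on_def)
  have "avg (\<Union>j\<in>insert i I. B j) (\<lambda>E. \<Prod>j\<in>insert i I. f j (E \<inter> B j))
      = avg (B i) (\<lambda>S. avg (\<Union>j\<in>I. B j) (\<lambda>T. \<Prod>j\<in>insert i I. f j ((S \<union> T) \<inter> B j)))"
    using avg_Un[OF _ _ disj] insert.prems(1) insert.hyps(1) by simp
  also have "\<dots> = avg (B i) (\<lambda>S. avg (\<Union>j\<in>I. B j) (\<lambda>T. f i S * (\<Prod>j\<in>I. f j (T \<inter> B j))))"
  proof (intro avg_cong)
    fix S T assume S: "S \<subseteq> B i" and T: "T \<subseteq> (\<Union>j\<in>I. B j)"
    have "(S \<union> T) \<inter> B i = S" using S T disj by blast
    moreover have "(S \<union> T) \<inter> B j = T \<inter> B j" if "j \<in> I" for j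
      using S that disj by blast
    ultimately show "(\<Prod>j\<in>insert i I. f j ((S \<union> T) \<inter> B j)) = f i S * (\<Prod>j\<in>I. f j (T \<inter> B j))"
      using insert.hyps by simp
  qed
  finally show ?case
    using insert.hyps by (simp add: avg_cmult avg_mult_right IH)
qed

text \<open>Elements of \<open>X\<close> outside all blocks do not influence the integrand, so
  averaging over them changes nothing.\<close>

lemma avg_prod_subset:
  assumes X: "finite X" and I: "finite I" and B: "\<And>i. i \<in> I \<Longrightarrow> B i \<subseteq> X" "disjoint_family_on B I"
  shows "avg X (\<lambda>E. \<Prod>i\<in>I. f i (E \<inter> B i)) = (\<Prod>i\<in>I. avg (B i) (f i))"
proof -
  define U where "U = (\<Union>i\<in>I. B i)"
  have U: "U \<subseteq> X" using B by (auto simp: U_def)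
  have fB: "finite (B i)" if "i \<in> I" for i using finite_subset[OF B(1) X] that by simp
  have "avg X (\<lambda>E. \<Prod>i\<in>I. f i (E \<inter> B i))
      = avg (X - U) (\<lambda>S. avg U (\<lambda>T. \<Prod>i\<in>I. f i ((S \<union> T) \<inter> B i)))"
    by (rule avg_split[OF X U])
  also have "\<dots> = avg (X - U) (\<lambda>S. avg U (\<lambda>T. \<Prod>i\<in>I. f i (T \<inter> B i)))"
  proof (intro avg_cong prod.cong refl)
    fix S T i assume "S \<subseteq> X - U" "T \<subseteq> U" "i \<in> I"
    then have "(S \<union> T) \<inter> B i = T \<inter> B i" by (auto simp: U_def)
    then show "f i ((S \<union> T) \<inter> B i) = f i (T \<inter> B i)" by simp
  qed
  also have "\<dots> = (\<Prod>i\<in>I. avg (B i) (f i))"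
    using X unfolding U_def by (simp add: avg_prod[OF I fB B(2)] avg_const)
  finally show ?thesis .
qed

lemma avg_eq_single:
  assumes "finite X" "H \<subseteq> X"
  shows "avg X (\<lambda>E. of_bool (E = H)) = 1 / 2 ^ card X"
proof -
  have "(\<Sum>E\<in>Pow X. of_bool (E = H) :: real) = (\<Sum>E\<in>{H}. 1)"
    using assms by (intro sum.mono_neutral_cong_right) auto
  then show ?thesis by (simp add: avg_def)
qed

section \<open>Probabilities of events: union bound and Markov's inequality\<close>

lemma dens_mono: "(\<And>E. E \<subseteq> X \<Longrightarrow> P E \<Longrightarrow> Q E) \<Longrightarrow> dens X P \<le> dens X Q"
  unfolding dens_def by (rule avg_mono) auto

lemma dens_nonneg: "0 \<le> dens X P"
  unfolding dens_def by (rule avg_nonneg) auto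

lemma dens_eq_card: "finite X \<Longrightarrow> dens X P = real (card {E \<in> Pow X. P E}) / 2 ^ card X"
  by (simp add: dens_def avg_def sum_of_bool_eq Int_def)

lemma dens_disj: "dens X (\<lambda>E. P E \<or> Q E) \<le> dens X P + dens X Q"
  unfolding dens_def avg_add[symmetric] by (rule avg_mono) auto

text \<open>The union bound.\<close>

lemma dens_Ex:
  fixes c :: real
  assumes "finite I" "\<And>i. i \<in> I \<Longrightarrow> dens X (P i) \<le> c"
  shows "dens X (\<lambda>E. \<exists>i\<in>I. P i E) \<le> card I * c"
proof -
  have "dens X (\<lambda>E. \<exists>i\<in>I. P i E) \<le> avg X (\<lambda>E. \<Sum>i\<in>I. of_bool (P i E))"
    unfolding dens_def
  proof (rule avg_mono)
    fix E
    show "of_bool (\<exists>i\<in>I. P i E) \<le> (\<Sum>i\<in>I. of_bool (P i E) :: real)"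
    proof (cases "\<exists>i\<in>I. P i E")
      case True
      then obtain i where i: "i \<in> I" "P i E" by blast
      have "of_bool (P i E) \<le> (\<Sum>i\<in>I. of_bool (P i E) :: real)"
        by (rule member_le_sum) (use i assms in auto)
      then show ?thesis using i by auto
    qed (simp add: sum_nonneg)
  qed
  also have "\<dots> = (\<Sum>i\<in>I. dens X (P i))"
    by (simp add: avg_sum dens_def)
  also have "\<dots> \<le> card I * c"
    using sum_bounded_above[of I "\<lambda>i. dens X (P i)" c] assms by simp
  finally show ?thesis .
qed

text \<open>Markov's inequality for the number of indices \<open>i\<close> for which
  \<open>P i\<close> occurs.\<close>

lemma dens_many_le:
  fixes c p :: real
  assumes I: "finite I" and c: "0 < c" and p: "\<And>i. i \<in> I \<Longrightarrow> dens X (P i) \<le> p"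
  shows "dens X (\<lambda>E. c < real (card {i \<in> I. P i E})) \<le> card I * p / c"
proof -
  have "dens X (\<lambda>E. c < real (card {i \<in> I. P i E})) \<le> avg X (\<lambda>E. (1 / c) * (\<Sum>i\<in>I. of_bool (P i E)))"
    unfolding dens_def
  proof (rule avg_mono)
    fix E
    have "(\<Sum>i\<in>I. of_bool (P i E) :: real) = real (card {i \<in> I. P i E})"
      using I by (simp add: sum_of_bool_eq Int_def)
    then show "of_bool (c < real (card {i \<in> I. P i E})) \<le> (1 / c) * (\<Sum>i\<in>I. of_bool (P i E) :: real)"
      using c by (auto simp: field_simps)
  qed
  also have "\<dots> = (1 / c) * (\<Sum>i\<in>I. dens X (P i))"
    by (simp only: avg_cmult avg_sum dens_def)
  also have "\<dots> \<le> (1 / c) * (card I * p)"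
    using sum_bounded_above[of I "\<lambda>i. dens X (P i)" p] p c by (intro mult_left_mono) auto
  finally show ?thesis by simp
qed

lemma dens_disjoint:
  assumes "finite X" "Z \<subseteq> X"
  shows "dens X (\<lambda>E. E \<inter> Z = {}) = 1 / 2 ^ card Z"
proof -
  have "dens X (\<lambda>E. E \<inter> Z = {}) = avg (X - Z) (\<lambda>S. avg Z (\<lambda>T. of_bool (T = {})))"
    unfolding dens_def avg_split[OF assms]
    by (intro avg_cong arg_cong[where f = of_bool]) blast
  also have "avg Z (\<lambda>T. of_bool (T = {})) = 1 / 2 ^ card Z"
    unfolding avg_def using assms finite_subset by (subst sum.remove[of _ "{}"]) auto
  finally show ?thesis using assms by (simp add: avg_const)
qed

section \<open>Anticoncentration and concentration\<close>

lemma central_binomial_le: "real ((2 * n) choose n) * sqrt (2 * n) \<le> 4 ^ n"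
proof -
  \<comment> \<open>The stronger factor \<open>3 * n + 1\<close> makes the induction close: with
    \<open>2 * n\<close> the step would require \<open>(2 * n + 1) ^ 2 <= 4 * n * (n + 1)\<close>,
    which fails by one.\<close>
  have "real ((2 * n) choose n) ^ 2 * (3 * n + 1) \<le> 16 ^ n"
  proof (induction n)
    case 0
    then show ?case by simp
  next
    case (Suc n)
    have rec: "real (Suc n) * real ((2 * Suc n) choose Suc n) = 2 * (2 * n + 1) * real ((2 * n) choose n)"
    proof -
      have 1: "Suc n * (Suc (Suc (2 * n)) choose Suc n) = Suc (Suc (2 * n)) * (Suc (2 * n) choose n)"
        by (rule Suc_times_binomial)
      have 2: "Suc n * (Suc (2 * n) choose Suc n) = Suc (2 * n) * ((2 * n) choose n)"
        by (rule Suc_times_binomial)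
      have 3: "Suc (2 * n) choose n = Suc (2 * n) choose Suc n"
        using binomial_symmetric[of n "Suc (2 * n)"] by simp
      have "Suc n * (Suc (Suc (2 * n)) choose Suc n) = 2 * (Suc n * (Suc (2 * n) choose Suc n))"
        unfolding 1 3 by simp
      then have "Suc n * ((2 * Suc n) choose Suc n) = 2 * (2 * n + 1) * ((2 * n) choose n)"
        unfolding 2 by (simp only: mult_Suc_right add_2_eq_Suc' add_2_eq_Suc) simp
      then show ?thesis by (metis of_nat_mult of_nat_add of_nat_1 of_nat_numeral)
    qed
    let ?b = "real ((2 * n) choose n)" and ?c = "real ((2 * Suc n) choose Suc n)"
    have sq: "real (Suc n) ^ 2 * ?c ^ 2 = 4 * (2 * n + 1) ^ 2 * ?b ^ 2"
      using arg_cong[OF rec, of "\<lambda>x. x ^ 2"] by (simp only: power_mult_distrib of_nat_mult of_nat_numeral) simp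
    have "4 * (2 * real n + 1) ^ 2 * (3 * Suc n + 1) \<le> 16 * real (Suc n) ^ 2 * (3 * n + 1)"
      by (simp add: power2_eq_square algebra_simps)
    then have "4 * (2 * real n + 1) ^ 2 * (3 * Suc n + 1) * ?b ^ 2 \<le> 16 * real (Suc n) ^ 2 * (3 * n + 1) * ?b ^ 2"
      by (rule mult_right_mono) simp
    also have "\<dots> \<le> 16 * real (Suc n) ^ 2 * 16 ^ n"
      using Suc.IH mult_left_mono[of "?b ^ 2 * (3 * n + 1)" "16 ^ n" "16 * real (Suc n) ^ 2"]
      by (simp add: mult_ac)
    finally have le: "4 * (2 * real n + 1) ^ 2 * (3 * Suc n + 1) * ?b ^ 2 \<le> real (Suc n) ^ 2 * 16 ^ Suc n"
      by (simp add: mult_ac)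
    have "real (Suc n) ^ 2 * (?c ^ 2 * (3 * Suc n + 1)) = real (Suc n) ^ 2 * ?c ^ 2 * (3 * Suc n + 1)"
      by (simp only: mult.assoc)
    also have "\<dots> = 4 * (2 * real n + 1) ^ 2 * (3 * Suc n + 1) * ?b ^ 2"
      unfolding sq by (simp add: mult_ac add_ac)
    also note le
    finally have "real (Suc n) ^ 2 * (?c ^ 2 * (3 * Suc n + 1)) \<le> real (Suc n) ^ 2 * 16 ^ Suc n" .
    then show ?case
      by (rule mult_left_le_imp_le) simp
  qed
  moreover have "real ((2 * n) choose n) ^ 2 * (2 * n) \<le> real ((2 * n) choose n) ^ 2 * (3 * n + 1)"
    by (rule mult_left_mono) auto
  ultimately have "real ((2 * n) choose n) ^ 2 * (2 * n) \<le> 16 ^ n"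
    by linarith
  moreover have "(4 ^ n)\<^sup>2 = (16 :: real) ^ n"
    unfolding power_mult[symmetric] mult.commute[of n] by (simp add: power_mult)
  ultimately have "(real ((2 * n) choose n) * sqrt (2 * n)) ^ 2 \<le> (4 ^ n) ^ 2"
    by (simp add: power_mult_distrib)
  then show ?thesis
    by (rule power2_le_imp_le) simp
qed

lemma binomial_le_sqrt:
  assumes "N > 0"
  shows "real (N choose k) / 2 ^ N \<le> 1 / sqrt N"
proof (cases "even N")
  case True
  then obtain m where m: "N = 2 * m" by blast
  have "real (N choose k) \<le> real ((2 * m) choose m)"
    using binomial_maximum[of N k] m by simp
  then have "real (N choose k) * sqrt N \<le> real ((2 * m) choose m) * sqrt (2 * m)"
    unfolding m by (intro mult_right_mono) auto
  also have "\<dots> \<le> 2 ^ N"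
    using central_binomial_le[of m] m by (simp add: power_mult)
  finally show ?thesis using assms by (simp add: field_simps)
next
  case False
  then obtain m where m: "N = Suc (2 * m)" using oddE by fastforce
  have "real (N choose k) \<le> real (N choose m)"
    using binomial_maximum[of N k] m by simp
  \<comment> \<open>The two middle coefficients of an odd row are equal and add up to the central
    one of the next row, which reduces the odd case to the even one.\<close>
  moreover have "2 * (N choose m) = (2 * Suc m) choose Suc m"
    using binomial_symmetric[of m "Suc (2 * m)"] by (simp add: m)
  then have "2 * real (N choose m) = real ((2 * Suc m) choose Suc m)"
    by (metis of_nat_mult of_nat_numeral)
  ultimately have "2 * real (N choose k) * sqrt N \<le> real ((2 * Suc m) choose Suc m) * sqrt (2 * Suc m)"
    unfolding m by (intro mult_mono) auto
  also have "\<dots> \<le> 2 * 2 ^ N"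
    using central_binomial_le[of "Suc m"] m by (simp add: power_mult)
  finally show ?thesis using assms by (simp add: field_simps)
qed

lemma dens_card_eq_le:
  assumes "finite B" "0 < M" "M \<le> real (card B)"
  shows "dens B (\<lambda>E. card E = t) \<le> 1 / sqrt M"
proof -
  have "dens B (\<lambda>E. card E = t) = real (card B choose t) / 2 ^ card B"
    using n_subsets[OF assms(1), of t] assms(1) by (simp add: dens_eq_card Pow_def)
  also have "\<dots> \<le> 1 / sqrt (card B)"
    by (rule binomial_le_sqrt) (use assms in linarith)
  also have "\<dots> \<le> 1 / sqrt M"
    using assms by (intro divide_left_mono) auto
  finally show ?thesis .
qed

section \<open>Exponential moments and Chernoff's bound\<close>

lemma avg_exp_sum:
  assumes "finite X"
  shows "avg X (\<lambda>E. exp (\<Sum>e\<in>E. a e)) = (\<Prod>e\<in>X. (1 + exp (a e :: real)) / 2)"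
  using assms
proof (induction X rule: finite_induct)
  case empty
  then show ?case by (simp add: avg_def)
next
  case (insert x X)
  have "avg (insert x X) (\<lambda>E. exp (\<Sum>e\<in>E. a e))
      = avg X (\<lambda>S. avg {x} (\<lambda>T. exp (\<Sum>e\<in>S \<union> T. a e)))"
    using avg_Un[of X "{x}"] insert.hyps by simp
  also have "\<dots> = avg X (\<lambda>S. exp (\<Sum>e\<in>S. a e) * ((1 + exp (a x)) / 2))"
  proof (rule avg_cong)
    fix S assume "S \<subseteq> X"
    then have "x \<notin> S" "finite S" using insert.hyps finite_subset by auto
    then show "avg {x} (\<lambda>T. exp (\<Sum>e\<in>S \<union> T. a e)) = exp (\<Sum>e\<in>S. a e) * ((1 + exp (a x)) / 2)"
      by (simp add: avg_def Pow_insert exp_add field_simps)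
  qed
  finally show ?case
    using insert by (simp only: avg_mult_right prod.insert) simp
qed

text \<open>Termwise comparison of Taylor series: the coefficients of \<open>x ^ (2 * n)\<close> are
  \<open>1 / fact (2 * n)\<close> and \<open>1 / (2 ^ n * fact n)\<close>.\<close>

lemma cosh_le_exp_half_sq: "cosh x \<le> exp (x\<^sup>2 / 2)" for x :: real
proof -
  have c: "(\<lambda>n. (if even n then x ^ n / fact n else 0)) sums cosh x"
    using cosh_converges[of x] by (simp add: field_simps if_distrib cong: if_cong)
  have e: "(\<lambda>n. (x\<^sup>2 / 2) ^ n / fact n) sums exp (x\<^sup>2 / 2)"
    using exp_converges[of "x\<^sup>2 / 2"] by (simp add: field_simps)
  have c': "(\<lambda>n. x ^ (2 * n) / fact (2 * n)) sums cosh x"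
    using c sums_mono_reindex[of "\<lambda>n. 2 * n" "\<lambda>n. (if even n then x ^ n / fact n else 0)" "cosh x"]
    by (force simp: strict_mono_def elim!: evenE)
  show ?thesis
  proof (rule sums_le[OF _ c' e])
    fix n
    have f: "(2 :: real) ^ n * fact n \<le> fact (2 * n)"
    proof (induction n)
      case (Suc n)
      have "(2 :: real) ^ Suc n * fact (Suc n) = (2 * (real n + 1)) * (2 ^ n * fact n)"
        by (simp add: algebra_simps)
      also have "\<dots> \<le> (2 * (real n + 1)) * fact (2 * n)"
        using Suc by (intro mult_left_mono) auto
      also have "\<dots> \<le> (2 * (real n + 1)) * ((2 * n + 1) * fact (2 * n))"
        by (intro mult_left_mono) auto
      also have "\<dots> = fact (2 * Suc n)" by (simp add: algebra_simps)
      finally show ?case .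
    qed simp
    have "x ^ (2 * n) / fact (2 * n) \<le> x ^ (2 * n) / (2 ^ n * fact n)"
      by (intro divide_left_mono f) (auto simp: power_mult)
    then show "x ^ (2 * n) / fact (2 * n) \<le> (x\<^sup>2 / 2) ^ n / fact n"
      by (simp add: power_mult power_divide)
  qed
qed

text \<open>Exponential Markov inequality. By independence the moment generating function is a
  product of factors \<open>(1 + exp y) / 2 = exp (y / 2) * cosh (y / 2)\<close>, and
  \<open>cosh_le_exp_half_sq\<close> gives each factor a Gaussian bound. Half the sum over
  \<open>X\<close> is the expectation.\<close>

lemma chernoff:
  fixes a :: "'a \<Rightarrow> real"
  assumes X: "finite X" and Q: "(\<Sum>e\<in>X. (a e)\<^sup>2) \<le> Q" "0 < Q" and t: "0 \<le> t"
  shows "dens X (\<lambda>E. (\<Sum>e\<in>X. a e) / 2 + t \<le> (\<Sum>e\<in>E. a e)) \<le> exp (- 2 * t\<^sup>2 / Q)"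
proof -
  \<comment> \<open>This value minimises the final exponent,
    \<open>l * l / 8 * Q - l * t\<close>.\<close>
  define l where "l = 4 * t / Q"
  define s where "s = (\<Sum>e\<in>X. a e) / 2 + t"
  have l: "l \<ge> 0" using t Q by (simp add: l_def)
  have "dens X (\<lambda>E. s \<le> (\<Sum>e\<in>E. a e)) \<le> avg X (\<lambda>E. exp (- l * s) * exp (\<Sum>e\<in>E. l * a e))"
    unfolding dens_def
  proof (rule avg_mono)
    fix E
    show "of_bool (s \<le> (\<Sum>e\<in>E. a e)) \<le> exp (- l * s) * exp (\<Sum>e\<in>E. l * a e)"
      using mult_left_mono[OF _ l, of s "\<Sum>e\<in>E. a e"]
      by (auto simp: exp_add[symmetric] sum_distrib_left[symmetric])
  qed
  also have "\<dots> = exp (- l * s) * (\<Prod>e\<in>X. (1 + exp (l * a e)) / 2)"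
    using X by (simp only: avg_cmult avg_exp_sum)
  also have "(\<Prod>e\<in>X. (1 + exp (l * a e)) / 2) \<le> (\<Prod>e\<in>X. exp (l * a e / 2 + (l * a e / 2)\<^sup>2 / 2))"
  proof (rule prod_mono)
    fix e
    have "(1 + exp (l * a e)) / 2 = exp (l * a e / 2) * cosh (l * a e / 2)"
      by (simp add: cosh_field_def exp_minus field_simps exp_add[symmetric])
    also have "\<dots> \<le> exp (l * a e / 2) * exp ((l * a e / 2)\<^sup>2 / 2)"
      by (intro mult_left_mono cosh_le_exp_half_sq) auto
    finally show "0 \<le> (1 + exp (l * a e)) / 2 \<and> (1 + exp (l * a e)) / 2 \<le> exp (l * a e / 2 + (l * a e / 2)\<^sup>2 / 2)"
      by (simp add: exp_add add_nonneg_nonneg)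
  qed
  also have "\<dots> = exp (l * ((\<Sum>e\<in>X. a e) / 2) + l\<^sup>2 / 8 * (\<Sum>e\<in>X. (a e)\<^sup>2))"
    using X by (simp add: exp_sum[symmetric] sum.distrib sum_distrib_left sum_divide_distrib power_mult_distrib power_divide algebra_simps)
  also have "exp (- l * s) * \<dots> = exp (- l * t + l\<^sup>2 / 8 * (\<Sum>e\<in>X. (a e)\<^sup>2))"
    by (simp add: exp_add[symmetric] s_def algebra_simps)
  also have "\<dots> \<le> exp (- l * t + l\<^sup>2 / 8 * Q)"
    using Q by (simp add: mult_left_mono)
  also have "- l * t + l\<^sup>2 / 8 * Q = - 2 * t\<^sup>2 / Q"
    using Q by (simp add: l_def field_simps power2_eq_square)
  finally show ?thesis
    by (simp add: s_def)
qed

section \<open>Random hypergraphs and coincidences of colours\<close>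

definition edges :: "nat \<Rightarrow> nat \<Rightarrow> nat set set" where
  "edges r n = {e. e \<subseteq> {1..n} \<and> card e = r}"

lemma finite_edges [simp]: "finite (edges r n)"
  unfolding edges_def by (rule finite_subset[of _ "Pow {1..n}"]) auto

lemma card_edges: "card (edges r n) = n choose r"
  unfolding edges_def using n_subsets[of "{1..n}" r] by simp

lemma almost_allI:
  assumes "(\<lambda>n. dens (edges r n) (\<lambda>E. \<not> P E)) \<longlonglongrightarrow> 0"
  shows "almost_all r P"
proof -
  have "dens (edges r n) (\<lambda>E. \<not> P E)
      = real (card {E \<in> uniform_hypergraphs r n. \<not> P E}) / 2 ^ (n choose r)" for n
    by (simp add: dens_eq_card card_edges uniform_hypergraphs_def) (simp add: edges_def)
  then show ?thesis
    unfolding almost_all_def using assms by (intro smalloI_tendsto) simp_all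
qed

lemma induced_colour_Un:
  assumes "finite F" "finite G" "F \<inter> G = {}"
  shows "induced_colour (F \<union> G) \<omega> v = induced_colour F \<omega> v + induced_colour G \<omega> v"
proof -
  have "{e \<in> F \<union> G. v \<in> e} = {e \<in> F. v \<in> e} \<union> {e \<in> G. v \<in> e}" by blast
  then show ?thesis
    unfolding induced_colour_def using assms by (simp add: sum.union_disjoint disjoint_iff)
qed

text \<open>Edges outside the blocks are revealed first. An edge of \<open>B v\<close> meets
  \<open>S\<close> only in \<open>v\<close>, so the blocks are disjoint, the colour of
  \<open>s\<close> is already fixed, and the colour of any other \<open>v\<close> in
  \<open>S\<close> still grows by \<open>w v\<close> times a binomial count. A coincidence
  prescribes all these independent counts, and each prescription succeeds with probability at most
  \<open>1 / sqrt M\<close>.\<close>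

lemma dens_equal_colours_le:
  fixes \<omega> :: "nat set \<Rightarrow> nat"
  assumes X: "finite X" and S: "finite S" "s \<in> S"
    and B: "\<And>v. v \<in> S - {s} \<Longrightarrow> B v \<subseteq> X"
    and B_inter: "\<And>v e u. v \<in> S - {s} \<Longrightarrow> e \<in> B v \<Longrightarrow> u \<in> S \<Longrightarrow> u \<in> e \<longleftrightarrow> u = v"
    and \<omega>: "\<And>v e. v \<in> S - {s} \<Longrightarrow> e \<in> B v \<Longrightarrow> \<omega> e = w v" "\<And>v. v \<in> S - {s} \<Longrightarrow> 0 < w v"
    and M: "0 < M" "\<And>v. v \<in> S - {s} \<Longrightarrow> M \<le> real (card (B v))"
  shows "dens X (\<lambda>E. \<forall>v\<in>S. induced_colour E \<omega> v = induced_colour E \<omega> s) \<le> (1 / sqrt M) ^ (card S - 1)"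
proof -
  define I where "I = S - {s}"
  define U where "U = (\<Union>v\<in>I. B v)"
  have fI: "finite I" and cI: "card I = card S - 1" using S by (auto simp: I_def)
  have UX: "U \<subseteq> X" using B by (auto simp: U_def I_def)
  have fB: "finite (B v)" if "v \<in> I" for v
    using finite_subset[OF B X] that by (simp add: I_def)
  have disj: "disjoint_family_on B I"
    using B_inter unfolding disjoint_family_on_def I_def by blast
  have "avg U (\<lambda>G. of_bool (\<forall>v\<in>S. induced_colour (F \<union> G) \<omega> v = induced_colour (F \<union> G) \<omega> s))
      \<le> (1 / sqrt M) ^ card I" if F: "F \<subseteq> X - U" for F
  proof -
    \<comment> \<open>The only count that can lift \<open>v\<close> to the colour of
      \<open>s\<close>. When the colours do coincide, the truncated subtraction and the division are
      exact.\<close>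
    define t where "t v = (induced_colour F \<omega> s - induced_colour F \<omega> v) div w v" for v
    have fin: "finite F" "finite U" using F X UX by (auto intro: finite_subset)
    have colour: "induced_colour (F \<union> G) \<omega> v = induced_colour F \<omega> v + induced_colour G \<omega> v"
      if "G \<subseteq> U" for G v
      using that F fin by (intro induced_colour_Un) (auto intro: finite_subset)
    have s0: "induced_colour G \<omega> s = 0" if "G \<subseteq> U" for G
    proof -
      have "{e \<in> G. s \<in> e} = {}"
        using that B_inter S unfolding U_def I_def by blast
      then show ?thesis unfolding induced_colour_def by (simp only: sum.empty)
    qed
    have sv: "induced_colour G \<omega> v = w v * card (G \<inter> B v)" if "G \<subseteq> U" "v \<in> I" for G v
    proof -
      have "{e \<in> G. v \<in> e} = G \<inter> B v"
        using that B_inter unfolding U_def I_def by blast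
      moreover have "(\<Sum>e\<in>G \<inter> B v. \<omega> e) = (\<Sum>e\<in>G \<inter> B v. w v)"
        by (rule sum.cong) (use \<omega>(1) that(2) in \<open>auto simp: I_def\<close>)
      ultimately show ?thesis unfolding induced_colour_def by simp
    qed
    have "avg U (\<lambda>G. of_bool (\<forall>v\<in>S. induced_colour (F \<union> G) \<omega> v = induced_colour (F \<union> G) \<omega> s))
        \<le> avg U (\<lambda>G. \<Prod>v\<in>I. of_bool (card (G \<inter> B v) = t v))"
    proof (rule avg_mono)
      fix G assume G: "G \<subseteq> U"
      have "card (G \<inter> B v) = t v"
        if "\<forall>v\<in>S. induced_colour (F \<union> G) \<omega> v = induced_colour (F \<union> G) \<omega> s" "v \<in> I" for v
      proof -
        have "induced_colour F \<omega> v + w v * card (G \<inter> B v) = induced_colour F \<omega> s"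
          using that colour[OF G] s0[OF G] sv[OF G] by (auto simp: I_def)
        then have "induced_colour F \<omega> s - induced_colour F \<omega> v = w v * card (G \<inter> B v)" by linarith
        then show ?thesis using \<omega>(2) that(2) by (simp add: t_def I_def)
      qed
      then show "of_bool (\<forall>v\<in>S. induced_colour (F \<union> G) \<omega> v = induced_colour (F \<union> G) \<omega> s)
          \<le> (\<Prod>v\<in>I. of_bool (card (G \<inter> B v) = t v) :: real)"
        by (auto simp: of_bool_def intro!: prod_nonneg)
    qed
    also have "\<dots> = (\<Prod>v\<in>I. dens (B v) (\<lambda>H. card H = t v))"
      unfolding U_def dens_def using avg_prod[OF fI fB disj, of "\<lambda>v H. of_bool (card H = t v)"] by simp
    also have "\<dots> \<le> (\<Prod>v\<in>I. 1 / sqrt M)"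
      using fB M by (intro prod_mono conjI dens_nonneg dens_card_eq_le) (auto simp: I_def)
    finally show ?thesis by simp
  qed
  then show ?thesis
    unfolding dens_def avg_split[OF X UX] cI[symmetric]
    using finite_Diff[OF X] by (rule_tac avg_le_const)
qed

section \<open>Uniformity at least four\<close>

text \<open>The only admissible weight is 1, and colours involve only the weights of edges in
  \<open>E\<close>, so every admissible weighting induces the vertex degrees as colours.\<close>

lemma not_weakly_weighted_1_iff:
  "\<not> weakly_weighted E 1 \<longleftrightarrow>
     (\<exists>e\<in>E. \<forall>u\<in>e. \<forall>v\<in>e. induced_colour E (\<lambda>_. 1) u = induced_colour E (\<lambda>_. 1) v)"
proof -
  let ?c = "induced_colour E (\<lambda>_. 1)"
  have eq: "induced_colour E \<omega> = ?c" if "\<forall>e\<in>E. \<omega> e \<in> {1..1}" for \<omega>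
  proof (intro ext)
    show "induced_colour E \<omega> v = ?c v" for v
      unfolding induced_colour_def by (rule sum.cong) (use that in fastforce)+
  qed
  have "weakly_weighted E 1 \<longleftrightarrow> (\<forall>e\<in>E. \<exists>u\<in>e. \<exists>v\<in>e. ?c u \<noteq> ?c v)"
  proof
    assume "weakly_weighted E 1"
    then obtain \<omega> where w: "\<forall>e\<in>E. \<omega> e \<in> {1..1}"
      and c: "\<forall>e\<in>E. \<exists>u\<in>e. \<exists>v\<in>e. induced_colour E \<omega> u \<noteq> induced_colour E \<omega> v"
      unfolding weakly_weighted_def by blast
    show "\<forall>e\<in>E. \<exists>u\<in>e. \<exists>v\<in>e. ?c u \<noteq> ?c v"
      using c unfolding eq[OF w] .
  next
    assume "\<forall>e\<in>E. \<exists>u\<in>e. \<exists>v\<in>e. ?c u \<noteq> ?c v"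
    then show "weakly_weighted E 1"
      unfolding weakly_weighted_def by (intro exI[of _ "\<lambda>_. 1"] conjI) simp_all
  qed
  then show ?thesis by blast
qed

lemma card_insert_image:
  assumes "v \<notin> A"
  shows "card (insert v ` {y. y \<subseteq> A \<and> P y}) = card {y. y \<subseteq> A \<and> P y}"
  by (rule card_image) (use assms in \<open>auto simp: inj_on_def\<close>)

text \<open>Union bound over at most \<open>n ^ r\<close> candidate sets \<open>S\<close>, with
  \<open>dens_equal_colours_le\<close> applied to the blocks of all edges that meet \<open>S\<close>
  in one given vertex.\<close>

lemma dens_not_weakly_weighted_1_le:
  assumes r: "r \<ge> 4" and n: "n \<ge> 2 * r"
  shows "dens (edges r n) (\<lambda>E. \<not> weakly_weighted E 1) \<le> (2 * real r) ^ r * sqrt (2 * real r / real n)"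
proof -
  \<comment> \<open>As \<open>n >= 2 * r\<close>, the number \<open>1 / x\<close> is at most
    \<open>(n - r) / (r - 1)\<close>, so a block, of size \<open>(n - r) choose (r - 1)\<close>, has
    at least \<open>(1 / x) ^ (r - 1)\<close> edges.\<close>
  define x where "x = 2 * real r / real n"
  have x: "0 < x" "x \<le> 1" using r n by (auto simp: x_def field_simps)
  let ?c = "\<lambda>E. induced_colour E (\<lambda>_. 1)"
  have "dens (edges r n) (\<lambda>E. \<not> weakly_weighted E 1)
      \<le> dens (edges r n) (\<lambda>E. \<exists>S\<in>edges r n. \<forall>v\<in>S. ?c E v = ?c E (SOME s. s \<in> S))"
  proof (rule dens_mono)
    fix E assume E: "E \<subseteq> edges r n" and "\<not> weakly_weighted E 1"
    then obtain S where S: "S \<in> E" "\<forall>u\<in>S. \<forall>v\<in>S. ?c E u = ?c E v"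
      unfolding not_weakly_weighted_1_iff by blast
    have "S \<noteq> {}" using S(1) E r by (auto simp: edges_def)
    then have "(SOME s. s \<in> S) \<in> S" by (simp add: some_in_eq)
    then show "\<exists>S\<in>edges r n. \<forall>v\<in>S. ?c E v = ?c E (SOME s. s \<in> S)"
      using S E by blast
  qed
  also have "\<dots> \<le> card (edges r n) * (sqrt x ^ (r - 1)) ^ (r - 1)"
  proof (rule dens_Ex)
    fix S assume S: "S \<in> edges r n"
    then have S': "finite S" "card S = r" "S \<subseteq> {1..n}" "S \<noteq> {}"
      using r finite_subset by (auto simp: edges_def)
    define s where "s = (SOME s. s \<in> S)"
    have s: "s \<in> S" using S' by (simp add: s_def some_in_eq)
    define Y where "Y = {y. y \<subseteq> {1..n} - S \<and> card y = r - 1}"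
    have cY: "card Y = (n - r) choose (r - 1)"
      unfolding Y_def using n_subsets[of "{1..n} - S" "r - 1"] S' by (simp add: card_Diff_subset)
    have M: "(1 / x) ^ (r - 1) \<le> real (card Y)"
    proof -
      have "1 / x \<le> real (n - r) / real (r - 1)"
      proof -
        have "real n * real (r - 1) \<le> real (n - r) * (2 * real r)"
        proof -
          have "real n * (real r - 1) \<le> (real n - real r) * (2 * real r)"
          proof -
            have "2 * real r * real r \<le> real n * real r"
              by (rule mult_right_mono) (use n in auto)
            then show ?thesis by (simp add: algebra_simps)
          qed
          then show ?thesis using r n by (simp add: of_nat_diff)
        qed
        then show ?thesis using r n by (simp add: x_def field_simps)
      qed
      then have "(1 / x) ^ (r - 1) \<le> (real (n - r) / real (r - 1)) ^ (r - 1)"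
        using x by (intro power_mono) auto
      also have "\<dots> \<le> real ((n - r) choose (r - 1))"
        using n by (intro binomial_ge_n_over_k_pow_k) simp
      finally show ?thesis by (simp add: cY)
    qed
    have "dens (edges r n) (\<lambda>E. \<forall>v\<in>S. ?c E v = ?c E s) \<le> (1 / sqrt ((1 / x) ^ (r - 1))) ^ (card S - 1)"
    proof (rule dens_equal_colours_le[where B = "\<lambda>v. insert v ` Y" and w = "\<lambda>_. 1"])
      fix v assume v: "v \<in> S - {s}"
      show "insert v ` Y \<subseteq> edges r n"
      proof
        fix e assume "e \<in> insert v ` Y"
        then obtain y where y: "e = insert v y" "y \<subseteq> {1..n} - S" "card y = r - 1"
          by (auto simp: Y_def)
        then have "finite y" "v \<notin> y" using v finite_subset by auto
        then show "e \<in> edges r n" using y v S' r by (auto simp: edges_def)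
      qed
      have "card (insert v ` Y) = card Y"
        unfolding Y_def by (rule card_insert_image) (use v in auto)
      then show "(1 / x) ^ (r - 1) \<le> real (card (insert v ` Y))"
        using M by simp
    qed (use S' s x in \<open>auto simp: Y_def\<close>)
    also have "1 / sqrt ((1 / x) ^ (r - 1)) = sqrt x ^ (r - 1)"
      by (simp add: real_sqrt_power real_sqrt_divide power_divide)
    finally show "dens (edges r n) (\<lambda>E. \<forall>v\<in>S. ?c E v = ?c E (SOME s. s \<in> S)) \<le> (sqrt x ^ (r - 1)) ^ (r - 1)"
      using S' by (simp add: s_def)
  qed simp
  also have "\<dots> \<le> real n ^ r * sqrt x ^ (2 * r + 1)"
  proof (rule mult_mono)
    show "real (card (edges r n)) \<le> real n ^ r"
      using binomial_le_pow[of r n] n unfolding card_edges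
      by (metis le_add1 le_trans mult_2 of_nat_le_iff of_nat_power)
    \<comment> \<open>This is where \<open>r >= 4\<close> enters, with equality at 4. Of the
      \<open>2 * r + 1\<close> factors \<open>sqrt x\<close>, all but one are used up by
      \<open>n ^ r\<close>; the last one tends to 0.\<close>
    have "2 * r + 1 \<le> (r - 1) * (r - 1)"
    proof -
      obtain k where k: "r = k + 4" using r le_Suc_ex by (metis add.commute)
      show ?thesis unfolding k by (simp add: algebra_simps)
    qed
    then show "(sqrt x ^ (r - 1)) ^ (r - 1) \<le> sqrt x ^ (2 * r + 1)"
      unfolding power_mult[symmetric] using x by (intro power_decreasing) auto
  qed (use x in auto)
  also have "\<dots> = (real n * x) ^ r * sqrt x"
    using x by (simp add: power_mult_distrib power_mult)
  also have "real n * x = 2 * real r"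
    using r n by (simp add: x_def)
  finally show ?thesis by (simp add: x_def)
qed

lemma almost_all_weakly_weighted_1:
  assumes "r \<ge> 4"
  shows "almost_all r (\<lambda>E. weakly_weighted E 1)"
proof (rule almost_allI, rule tendsto_sandwich)
  show "\<forall>\<^sub>F n in sequentially. 0 \<le> dens (edges r n) (\<lambda>E. \<not> weakly_weighted E 1)"
    by (simp add: dens_nonneg)
  show "\<forall>\<^sub>F n in sequentially. dens (edges r n) (\<lambda>E. \<not> weakly_weighted E 1)
      \<le> (2 * real r) ^ r * sqrt (2 * real r / real n)"
    using eventually_ge_at_top[of "2 * r"]
    by eventually_elim (rule dens_not_weakly_weighted_1_le[OF assms])
  have "(\<lambda>n. (2 * real r) ^ r * sqrt (2 * real r / real n)) \<longlonglongrightarrow> (2 * real r) ^ r * sqrt 0"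
    by (intro tendsto_intros lim_const_over_n)
  then show "(\<lambda>n. (2 * real r) ^ r * sqrt (2 * real r / real n)) \<longlonglongrightarrow> 0"
    by simp
qed simp

section \<open>Weighting triples by their vertex sum\<close>

text \<open>The threshold is about the average vertex sum of a triple, so raising a vertex of a
  triple changes the weight for many choices of the other two. The weighting is fixed before the
  random hypergraph is drawn.\<close>

definition sum_weight :: "nat \<Rightarrow> nat set \<Rightarrow> nat" where
  "sum_weight n e = (if \<Sum>e > 3 * n div 2 then 2 else 1)"

text \<open>The sum \<open>s\<close> of such a pair takes \<open>j - i\<close> values, all roughly
  between \<open>n / 2\<close> and \<open>3 * n / 2\<close>, and each is attained by at least
  \<open>n / 8\<close> pairs. For exactly these pairs \<open>insert i y\<close> has weight 1 and
  \<open>insert j y\<close> has weight 2.\<close>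

lemma card_pairs_sum_window:
  assumes ij: "1 \<le> i" "i < j" "j \<le> n" and n: "40 \<le> n"
  defines "T \<equiv> 3 * n div 2"
  shows "(j - i) * n \<le> 8 * card {y. y \<subseteq> {1..n} - {i, j} \<and> card y = 2 \<and> \<Sum>y + i \<le> T \<and> T < \<Sum>y + j}"
proof -
  \<comment> \<open>\<open>x\<close> is the smaller element of the pair \<open>{x, s - x}\<close>:
    the lower limit keeps \<open>s - x <= n\<close>, the upper one gives \<open>x < s - x\<close>,
    and the four deleted values keep \<open>i\<close> and \<open>j\<close> out of the pair.\<close>
  define W where "W s = {max 1 (s - n)..(s - 1) div 2} - {i, j, s - i, s - j}" for s
  define P where "P = (SIGMA s:{T - j<..T - i}. W s)"
  let ?R = "{y. y \<subseteq> {1..n} - {i, j} \<and> card y = 2 \<and> \<Sum>y + i \<le> T \<and> T < \<Sum>y + j}"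
  have W: "n \<le> 8 * card (W s)" if s: "s \<in> {T - j<..T - i}" for s
  proof -
    have fin: "finite {i, j, s - i, s - j}" by simp
    have "card {i, j, s - i, s - j} \<le> 4"
      by (intro order.trans[OF card_insert_le_m1]) auto
    then have "card {max 1 (s - n)..(s - 1) div 2} \<le> card (W s) + 4"
      unfolding W_def using diff_card_le_card_Diff[of "{i, j, s - i, s - j}" "{max 1 (s - n)..(s - 1) div 2}", OF fin]
      by linarith
    then have "(s - 1) div 2 + 1 - max 1 (s - n) \<le> card (W s) + 4" by simp
    moreover have "s \<le> 3 * n div 2 - 1" "3 * n div 2 - n < s" using s ij by (auto simp: T_def)
    \<comment> \<open>The interval has about \<open>n / 4\<close> members at worst; after losing
      four, \<open>n / 8\<close> remain once \<open>n >= 40\<close>.\<close>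
    ultimately show ?thesis using n by (auto simp: max_def split: if_splits)
  qed
  have "(\<lambda>(s, x). {x, s - x}) ` P \<subseteq> ?R"
  proof clarify
    fix s x assume "(s, x) \<in> P"
    then have s: "T - j < s" "s \<le> T - i" and x: "1 \<le> x" "s - n \<le> x" "x \<le> (s - 1) div 2"
      and ne: "x \<noteq> i" "x \<noteq> j" "x \<noteq> s - i" "x \<noteq> s - j"
      by (auto simp: P_def W_def)
    have lt: "x < s - x" "x \<le> s" using x by linarith+
    have Tj: "j \<le> T" using ij by (simp add: T_def)
    have sx: "s - x \<le> n" using x(2) by linarith
    have "s - x \<noteq> i" using ne(3) lt(2) by linarith
    moreover have "s - x \<noteq> j" using ne(4) lt(2) by linarith
    moreover have "x \<le> n" "1 \<le> s - x" using sx lt(1) by linarith+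
    ultimately have "{x, s - x} \<subseteq> {1..n} - {i, j}" using x(1) ne(1,2) sx by simp
    moreover have "card {x, s - x} = 2" using lt by simp
    moreover have "\<Sum>{x, s - x} = s" using lt by simp
    moreover have "s + i \<le> T" "T < s + j" using s Tj ij by linarith+
    ultimately show "{x, s - x} \<subseteq> {1..n} - {i, j} \<and> card {x, s - x} = 2 \<and> \<Sum>{x, s - x} + i \<le> T \<and> T < \<Sum>{x, s - x} + j"
      by simp
  qed
  moreover have "inj_on (\<lambda>(s, x). {x, s - x}) P"
  proof (rule inj_onI, clarify)
    fix s x s' x' assume "(s, x) \<in> P" "(s', x') \<in> P" and eq: "{x, s - x} = {x', s' - x'}"
    then have "x \<le> (s - 1) div 2" "x' \<le> (s' - 1) div 2" "1 \<le> x" "1 \<le> x'"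
      by (auto simp: P_def W_def)
    then have lt: "x < s - x" "x' < s' - x'" by linarith+
    \<comment> \<open>The crosswise match is impossible because \<open>x\<close> and
      \<open>x'\<close> are the smaller elements of their pairs.\<close>
    moreover have "x = x' \<and> s - x = s' - x' \<or> x = s' - x' \<and> s - x = x'"
      using eq by (simp only: doubleton_eq_iff)
    ultimately have "x = x'" "s - x = s' - x'" by (elim disjE conjE; linarith)+
    then show "s = s' \<and> x = x'" using lt by linarith
  qed
  ultimately have "card P \<le> card ?R"
    by (intro card_inj_on_le[where f = "\<lambda>(s, x). {x, s - x}"]) (auto intro: finite_subset[of _ "Pow {1..n}"])
  moreover have "(j - i) * n \<le> 8 * card P"
  proof -
    have "j \<le> T" using ij by (simp add: T_def)
    then have "(j - i) * n = (\<Sum>s\<in>{T - j<..T - i}. n)" using ij by simp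
    also have "\<dots> \<le> (\<Sum>s\<in>{T - j<..T - i}. 8 * card (W s))" by (intro sum_mono W)
    also have "\<dots> = 8 * card P"
      unfolding P_def by (simp add: W_def sum_distrib_left)
    finally show ?thesis .
  qed
  ultimately show ?thesis by linarith
qed

lemma edges_separating:
  assumes "p \<in> {1..n}" "p \<noteq> q"
  shows "{e \<in> edges 3 n. p \<in> e \<and> q \<notin> e} = insert p ` {y. y \<subseteq> {1..n} - {p, q} \<and> card y = 2}"
    (is "?L = insert p ` ?Y")
proof (intro equalityI subsetI)
  fix e assume e: "e \<in> ?L"
  then have "e = insert p (e - {p})" "e - {p} \<in> ?Y" by (auto simp: edges_def)
  then show "e \<in> insert p ` ?Y" by blast
next
  fix e assume "e \<in> insert p ` ?Y"
  then obtain y where y: "e = insert p y" "y \<subseteq> {1..n} - {p, q}" "card y = 2" by blast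
  then have "finite y" "p \<notin> y" by (auto intro: finite_subset)
  then have "card e = 3" using y by simp
  then show "e \<in> ?L" using y assms by (auto simp: edges_def)
qed

text \<open>Edges containing both or neither of \<open>i\<close> and \<open>j\<close> cancel in the
  colour difference. The others are matched as \<open>insert i y\<close> and
  \<open>insert j y\<close>, whose weights differ only if the threshold separates their vertex sums.
  By \<open>card_pairs_sum_window\<close> the expected difference is then at least
  \<open>(j - i) * n / 16\<close> in absolute value, and Chernoff's bound applies.\<close>

lemma dens_colours_eq_le:
  assumes ij: "1 \<le> i" "i < j" "j \<le> n" and n: "40 \<le> n"
  shows "dens (edges 3 n) (\<lambda>E. induced_colour E (sum_weight n) i = induced_colour E (sum_weight n) j)
    \<le> exp (- (real (j - i))\<^sup>2 / 512)"
proof -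
  let ?X = "edges 3 n" and ?\<omega> = "\<lambda>e. real (sum_weight n e)"
  define Y where "Y = {y. y \<subseteq> {1..n} - {i, j} \<and> card y = 2}"
  \<comment> \<open>The contribution of \<open>e\<close> to the colour of \<open>i\<close> minus
    that of \<open>j\<close>.\<close>
  define a where "a e = ?\<omega> e * (of_bool (i \<in> e) - of_bool (j \<in> e))" for e
  define D where "D = real (j - i) * real n / 8"
  have fY: "finite Y" unfolding Y_def by (rule finite_subset[of _ "Pow {1..n}"]) auto
  have finY: "finite y \<and> i \<notin> y \<and> j \<notin> y" if "y \<in> Y" for y
    using that by (auto simp: Y_def intro: finite_subset)
  have inj: "inj_on (insert i) Y" "inj_on (insert j) Y"
    by (auto simp: inj_on_def Y_def)
  have Yi: "{e \<in> ?X. i \<in> e \<and> j \<notin> e} = insert i ` Y"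
    unfolding Y_def by (rule edges_separating) (use ij in auto)
  have Yj: "{e \<in> ?X. j \<in> e \<and> i \<notin> e} = insert j ` Y"
    unfolding Y_def insert_commute[of i j] by (rule edges_separating) (use ij in auto)
  have split_sum: "(\<Sum>e\<in>?X. f e) = (\<Sum>y\<in>Y. f (insert i y)) + (\<Sum>y\<in>Y. f (insert j y))"
    if "\<And>e. i \<in> e \<longleftrightarrow> j \<in> e \<Longrightarrow> f e = 0" for f :: "nat set \<Rightarrow> real"
  proof -
    have "(\<Sum>e\<in>?X. f e) = (\<Sum>e\<in>insert i ` Y \<union> insert j ` Y. f e)"
      unfolding Yi[symmetric] Yj[symmetric] using that by (intro sum.mono_neutral_right) auto
    also have "\<dots> = (\<Sum>e\<in>insert i ` Y. f e) + (\<Sum>e\<in>insert j ` Y. f e)"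
      unfolding Yi[symmetric] Yj[symmetric] by (intro sum.union_disjoint) auto
    finally show ?thesis using inj by (simp add: sum.reindex)
  qed
  have colour: "(\<Sum>e\<in>E. a e)
      = real (induced_colour E (sum_weight n) i) - real (induced_colour E (sum_weight n) j)"
    if "E \<subseteq> ?X" for E
  proof -
    have fE: "finite E" using finite_subset[OF that] by simp
    have "real (induced_colour E (sum_weight n) v) = (\<Sum>e\<in>E. ?\<omega> e * of_bool (v \<in> e))" for v
      unfolding induced_colour_def using fE by (simp add: sum.inter_filter[symmetric] of_bool_def if_distrib cong: if_cong)
    then show ?thesis by (simp add: a_def right_diff_distrib sum_subtractf)
  qed
  have "(\<Sum>e\<in>?X. a e) = (\<Sum>y\<in>Y. a (insert i y) + a (insert j y))"
    unfolding sum.distrib by (rule split_sum) (simp add: a_def)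
  also have "\<dots> = (\<Sum>y\<in>Y. - of_bool (\<Sum>y + i \<le> 3 * n div 2 \<and> 3 * n div 2 < \<Sum>y + j))"
  proof (rule sum.cong)
    fix y assume "y \<in> Y"
    then show "a (insert i y) + a (insert j y) = - of_bool (\<Sum>y + i \<le> 3 * n div 2 \<and> 3 * n div 2 < \<Sum>y + j)"
      using finY[of y] ij by (auto simp: a_def sum_weight_def)
  qed simp
  also have "\<dots> = - real (card {y. y \<subseteq> {1..n} - {i, j} \<and> card y = 2 \<and> \<Sum>y + i \<le> 3 * n div 2 \<and> 3 * n div 2 < \<Sum>y + j})"
    unfolding sum_negf using fY by (simp add: sum_of_bool_eq Int_def Y_def conj_assoc)
  also have "\<dots> \<le> - D"
  proof -
    have "real ((j - i) * n) \<le> real (8 * card {y. y \<subseteq> {1..n} - {i, j} \<and> card y = 2 \<and> \<Sum>y + i \<le> 3 * n div 2 \<and> 3 * n div 2 < \<Sum>y + j})"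
      using card_pairs_sum_window[OF assms] by (simp only: of_nat_le_iff)
    then show ?thesis by (simp add: D_def)
  qed
  finally have mean: "(\<Sum>e\<in>?X. a e) \<le> - D" .
  have "(\<Sum>e\<in>?X. (a e)\<^sup>2) = (\<Sum>y\<in>Y. (a (insert i y))\<^sup>2) + (\<Sum>y\<in>Y. (a (insert j y))\<^sup>2)"
    by (rule split_sum) (simp add: a_def)
  also have "\<dots> \<le> (\<Sum>y\<in>Y. 4) + (\<Sum>y\<in>Y. 4)"
    by (intro add_mono sum_mono) (auto simp: a_def sum_weight_def)
  also have "\<dots> = 8 * real (card Y)" by simp
  also have "card Y = (n - 2) choose 2"
    unfolding Y_def using n_subsets[of "{1..n} - {i, j}" 2] ij by (simp add: card_Diff_subset numeral_2_eq_2)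
  also have "8 * real ((n - 2) choose 2) \<le> 4 * (real n)\<^sup>2"
  proof -
    have "2 * ((n - 2) choose 2) \<le> (n - 2) * (n - 3)" by (simp add: choose_two)
    also have "\<dots> \<le> n * n" by (intro mult_mono) auto
    finally have "real (2 * ((n - 2) choose 2)) \<le> real (n * n)" by (simp only: of_nat_le_iff)
    then show ?thesis by (simp add: power2_eq_square)
  qed
  finally have Q: "(\<Sum>e\<in>?X. (a e)\<^sup>2) \<le> 4 * (real n)\<^sup>2" .
  \<comment> \<open>Equal colours make the sum of \<open>a\<close> over \<open>E\<close> zero,
    whereas its expectation, half the sum over all triples, is at most
    \<open>- D / 2\<close>.\<close>
  have "dens ?X (\<lambda>E. induced_colour E (sum_weight n) i = induced_colour E (sum_weight n) j)
      \<le> dens ?X (\<lambda>E. (\<Sum>e\<in>?X. a e) / 2 + D / 2 \<le> (\<Sum>e\<in>E. a e))"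
  proof (rule dens_mono)
    fix E assume "E \<subseteq> ?X" "induced_colour E (sum_weight n) i = induced_colour E (sum_weight n) j"
    then show "(\<Sum>e\<in>?X. a e) / 2 + D / 2 \<le> (\<Sum>e\<in>E. a e)"
      using colour[of E] mean by linarith
  qed
  also have "\<dots> \<le> exp (- 2 * (D / 2)\<^sup>2 / (4 * (real n)\<^sup>2))"
    by (rule chernoff) (use Q n in \<open>auto simp: D_def\<close>)
  also have "- 2 * (D / 2)\<^sup>2 / (4 * (real n)\<^sup>2) = - (real (j - i))\<^sup>2 / 512"
    using n by (simp add: D_def power2_eq_square)
  finally show ?thesis .
qed

text \<open>\<open>dens_equal_colours_le\<close> needs blocks of constant weight. At each vertex one
  of the two weights is taken by at least half of the triples that meet \<open>S\<close> only there,
  which leaves \<open>n * n / 16\<close> edges; the two remaining vertices of \<open>S\<close> each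
  contribute a factor \<open>4 / n\<close>.\<close>

lemma dens_triple_colours_eq_le:
  assumes S: "S \<in> edges 3 n" "s \<in> S" and n: "40 \<le> n"
  shows "dens (edges 3 n) (\<lambda>E. \<forall>v\<in>S. induced_colour E (sum_weight n) v = induced_colour E (sum_weight n) s)
    \<le> 16 / (real n)\<^sup>2"
proof -
  have S': "finite S" "card S = 3" "S \<subseteq> {1..n}"
    using S finite_subset by (auto simp: edges_def)
  define Z where "Z v k = {y. y \<subseteq> {1..n} - S \<and> (card y = 2 \<and> sum_weight n (insert v y) = k)}" for v k
  \<comment> \<open>The majority weight among the triples \<open>insert v y\<close> with
    \<open>y\<close> outside \<open>S\<close>.\<close>
  define w where "w v = (if card (Z v 1) \<le> card (Z v 2) then 2 else 1 :: nat)" for v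
  have fZ: "finite (Z v k)" for v k
    unfolding Z_def by (rule finite_subset[of _ "Pow {1..n}"]) auto
  have "(real n)\<^sup>2 / 16 \<le> real (card (Z v (w v)))" for v
  proof -
    have "Z v 1 \<union> Z v 2 = {y. y \<subseteq> {1..n} - S \<and> card y = 2}"
      by (auto simp: Z_def sum_weight_def)
    moreover have "card \<dots> = (n - 3) choose 2"
      using n_subsets[of "{1..n} - S" 2] S' by (simp add: card_Diff_subset)
    moreover have "Z v 1 \<inter> Z v 2 = {}" by (auto simp: Z_def)
    ultimately have "(n - 3) choose 2 = card (Z v 1) + card (Z v 2)"
      using card_Un_disjoint[OF fZ fZ] by metis
    then have "(n - 3) choose 2 \<le> 2 * card (Z v (w v))" by (auto simp: w_def)
    moreover have "n * n \<le> 8 * ((n - 3) choose 2)"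
    proof -
      obtain k where k: "n = k + 40" using n le_Suc_ex by (metis add.commute)
      have "8 * ((n - 3) choose 2) = 4 * ((n - 3) * (n - 4))"
        by (simp add: choose_two)
      also have "\<dots> \<ge> n * n" unfolding k by (simp add: algebra_simps)
      finally show ?thesis .
    qed
    ultimately have "n * n \<le> 16 * card (Z v (w v))" by linarith
    then have "real (n * n) \<le> real (16 * card (Z v (w v)))" by (simp only: of_nat_le_iff)
    then show ?thesis by (simp add: power2_eq_square)
  qed
  note big = this
  have "dens (edges 3 n) (\<lambda>E. \<forall>v\<in>S. induced_colour E (sum_weight n) v = induced_colour E (sum_weight n) s)
      \<le> (1 / sqrt ((real n)\<^sup>2 / 16)) ^ (card S - 1)"
  proof (rule dens_equal_colours_le[where B = "\<lambda>v. insert v ` Z v (w v)" and w = w])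
    fix v assume v: "v \<in> S - {s}"
    show "insert v ` Z v (w v) \<subseteq> edges 3 n"
    proof
      fix e assume "e \<in> insert v ` Z v (w v)"
      then obtain y where y: "e = insert v y" "y \<subseteq> {1..n} - S" "card y = 2"
        by (auto simp: Z_def)
      then have "finite y" "v \<notin> y" using v finite_subset by auto
      then show "e \<in> edges 3 n" using y v S' by (auto simp: edges_def)
    qed
    have "card (insert v ` Z v (w v)) = card (Z v (w v))"
      unfolding Z_def by (rule card_insert_image) (use v in auto)
    then show "(real n)\<^sup>2 / 16 \<le> real (card (insert v ` Z v (w v)))"
      using big by simp
  qed (use S S' n in \<open>auto simp: Z_def w_def\<close>)
  also have "\<dots> = 16 / (real n)\<^sup>2"
    using S' by (simp add: power_divide real_sqrt_divide)
  finally show ?thesis .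
qed

text \<open>Such a triple is determined by its least vertex \<open>m\<close> and two of the
  \<open>d - 1\<close> numbers following \<open>m\<close>.\<close>

lemma card_narrow_triples:
  "card {e \<in> edges 3 n. Max e - Min e < d} \<le> n * d\<^sup>2"
proof -
  define Y where "Y m = {y. y \<subseteq> {m<..<m + d} \<and> card y = 2}" for m :: nat
  have cY: "card (insert m ` Y m) \<le> d\<^sup>2" for m
  proof -
    have "card (insert m ` Y m) \<le> card (Y m)"
      by (rule card_image_le) (auto simp: Y_def intro: finite_subset[of _ "Pow {m<..<m + d}"])
    also have "\<dots> = (d - 1) choose 2"
      unfolding Y_def using n_subsets[of "{m<..<m + d}" 2] by simp
    also have "\<dots> \<le> (d - 1) * (d - 1 - 1)" by (simp add: choose_two)
    also have "\<dots> \<le> d * d" by (intro mult_mono) auto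
    finally show ?thesis by (simp add: power2_eq_square)
  qed
  have "{e \<in> edges 3 n. Max e - Min e < d} \<subseteq> (\<Union>m\<in>{1..n}. insert m ` Y m)"
  proof
    fix e assume e: "e \<in> {e \<in> edges 3 n. Max e - Min e < d}"
    then have fe: "finite e" "e \<noteq> {}" by (auto simp: edges_def intro: finite_subset)
    have m: "Min e \<in> e" using fe by simp
    have interval: "y \<in> {Min e<..<Min e + d}" if "y \<in> e - {Min e}" for y
    proof -
      have "Min e \<le> y" "y \<le> Max e" "y \<noteq> Min e" using that fe by auto
      then show ?thesis using e by auto
    qed
    have "card (e - {Min e}) = 2" using e m by (auto simp: edges_def)
    then have "e - {Min e} \<in> Y (Min e)" unfolding Y_def using interval by blast
    moreover have "e = insert (Min e) (e - {Min e})" using m by blast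
    moreover have "Min e \<in> {1..n}" using m e by (auto simp: edges_def)
    ultimately show "e \<in> (\<Union>m\<in>{1..n}. insert m ` Y m)" by blast
  qed
  moreover have "finite (\<Union>m\<in>{1..n}. insert m ` Y m)"
    by (auto simp: Y_def intro: finite_subset[of _ "Pow {_<..<_ + d}"])
  ultimately have "card {e \<in> edges 3 n. Max e - Min e < d} \<le> card (\<Union>m\<in>{1..n}. insert m ` Y m)"
    by (rule card_mono[rotated])
  also have "\<dots> \<le> (\<Sum>m\<in>{1..n}. card (insert m ` Y m))" by (rule card_UN_le) simp
  also have "\<dots> \<le> n * d\<^sup>2" using sum_mono[of "{1..n}" "\<lambda>m. card (insert m ` Y m)" "\<lambda>_. d\<^sup>2", OF cY] by simp
  finally show ?thesis .
qed

text \<open>If \<open>sum_weight\<close> leaves a monochromatic edge, its extreme vertices form one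
  of at most \<open>n * n\<close> pairs at distance at least \<open>d\<close>, or it is one of at
  most \<open>n * d * d\<close> narrow triples. The two summands are the union bounds for these
  cases.\<close>

lemma dens_not_weakly_weighted_2_le:
  assumes n: "40 \<le> n" and d: "0 < d"
  shows "dens (edges 3 n) (\<lambda>E. \<not> weakly_weighted E 2)
    \<le> (real n)\<^sup>2 * exp (- (real d)\<^sup>2 / 512) + 16 * (real d)\<^sup>2 / real n"
proof -
  let ?c = "\<lambda>E. induced_colour E (sum_weight n)"
  define wide where "wide = {(i, j). 1 \<le> i \<and> i + d \<le> j \<and> j \<le> n}"
  define narrow where "narrow = {e \<in> edges 3 n. Max e - Min e < d}"
  have wide: "wide \<subseteq> {1..n} \<times> {1..n}" by (auto simp: wide_def)
  have "dens (edges 3 n) (\<lambda>E. \<not> weakly_weighted E 2) \<le>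
    dens (edges 3 n) (\<lambda>E. (\<exists>p\<in>wide. ?c E (fst p) = ?c E (snd p)) \<or> (\<exists>e\<in>narrow. \<forall>v\<in>e. ?c E v = ?c E (Min e)))"
  proof (rule dens_mono)
    fix E assume E: "E \<subseteq> edges 3 n" and "\<not> weakly_weighted E 2"
    moreover have "\<forall>e\<in>E. sum_weight n e \<in> {1..2}" by (simp add: sum_weight_def)
    ultimately obtain e where e: "e \<in> E" and eq: "\<And>u v. u \<in> e \<Longrightarrow> v \<in> e \<Longrightarrow> ?c E u = ?c E v"
      unfolding weakly_weighted_def by blast
    have e': "e \<in> edges 3 n" using e E by blast
    then have fe: "finite e" "e \<noteq> {}" by (auto simp: edges_def intro: finite_subset)
    have mem: "Min e \<in> e" "Max e \<in> e" using fe by auto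
    show "(\<exists>p\<in>wide. ?c E (fst p) = ?c E (snd p)) \<or> (\<exists>e\<in>narrow. \<forall>v\<in>e. ?c E v = ?c E (Min e))"
    proof (cases "Max e - Min e < d")
      case True
      then have "e \<in> narrow" using e' by (simp add: narrow_def)
      then show ?thesis using eq mem by blast
    next
      case False
      then have "(Min e, Max e) \<in> wide"
        using mem e' d by (auto simp: wide_def edges_def)
      then show ?thesis using eq[OF mem] by force
    qed
  qed
  also have "\<dots> \<le> dens (edges 3 n) (\<lambda>E. \<exists>p\<in>wide. ?c E (fst p) = ?c E (snd p))
      + dens (edges 3 n) (\<lambda>E. \<exists>e\<in>narrow. \<forall>v\<in>e. ?c E v = ?c E (Min e))"
    by (rule dens_disj)
  also have "\<dots> \<le> card wide * exp (- (real d)\<^sup>2 / 512) + card narrow * (16 / (real n)\<^sup>2)"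
  proof (intro add_mono dens_Ex)
    fix p assume p: "p \<in> wide"
    then have "dens (edges 3 n) (\<lambda>E. ?c E (fst p) = ?c E (snd p)) \<le> exp (- (real (snd p - fst p))\<^sup>2 / 512)"
      using n d by (intro dens_colours_eq_le) (auto simp: wide_def)
    also have "\<dots> \<le> exp (- (real d)\<^sup>2 / 512)"
      using p by (auto simp: wide_def)
    finally show "dens (edges 3 n) (\<lambda>E. ?c E (fst p) = ?c E (snd p)) \<le> exp (- (real d)\<^sup>2 / 512)" .
  next
    fix e assume e: "e \<in> narrow"
    then have "finite e" "e \<noteq> {}" by (auto simp: narrow_def edges_def intro: finite_subset)
    then show "dens (edges 3 n) (\<lambda>E. \<forall>v\<in>e. ?c E v = ?c E (Min e)) \<le> 16 / (real n)\<^sup>2"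
      using e n by (intro dens_triple_colours_eq_le) (auto simp: narrow_def)
  qed (use wide in \<open>auto simp: narrow_def intro: finite_subset\<close>)
  also have "\<dots> \<le> (real n)\<^sup>2 * exp (- (real d)\<^sup>2 / 512) + (real n * (real d)\<^sup>2) * (16 / (real n)\<^sup>2)"
  proof (intro add_mono mult_right_mono)
    have "card wide \<le> n * n" using card_mono[OF _ wide] by simp
    then show "real (card wide) \<le> (real n)\<^sup>2"
      by (metis of_nat_le_iff of_nat_mult power2_eq_square)
    show "real (card narrow) \<le> real n * (real d)\<^sup>2"
      using card_narrow_triples[of n d] unfolding narrow_def
      by (metis of_nat_le_iff of_nat_mult of_nat_power)
  qed auto
  also have "(real n * (real d)\<^sup>2) * (16 / (real n)\<^sup>2) = 16 * (real d)\<^sup>2 / real n"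
    using n by (simp add: power2_eq_square)
  finally show ?thesis .
qed

lemma tendsto_dens_not_weakly_weighted_2:
  "(\<lambda>n. dens (edges 3 n) (\<lambda>E. \<not> weakly_weighted E 2)) \<longlonglongrightarrow> 0"
proof (rule tendsto_sandwich)
  show "\<forall>\<^sub>F n in sequentially. 0 \<le> dens (edges 3 n) (\<lambda>E. \<not> weakly_weighted E 2)"
    by (simp add: dens_nonneg)
  show "\<forall>\<^sub>F n in sequentially. dens (edges 3 n) (\<lambda>E. \<not> weakly_weighted E 2)
      \<le> (real n)\<^sup>2 * exp (- (real n powr (1 / 4))\<^sup>2 / 512) + 16 * (2 * real n powr (1 / 4))\<^sup>2 / real n"
    using eventually_ge_at_top[of 40]
  proof eventually_elim
    case (elim n)
    \<comment> \<open>The square of \<open>d\<close> has order \<open>sqrt n\<close>: enough for the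
      exponential to beat the number of pairs, yet small compared with \<open>n\<close>.\<close>
    define d where "d = nat \<lceil>real n powr (1 / 4)\<rceil>"
    have 1: "1 \<le> real n powr (1 / 4)" using elim by (simp add: ge_one_powr_ge_zero)
    then have d: "real n powr (1 / 4) \<le> real d" "real d \<le> 2 * real n powr (1 / 4)" "0 < d"
      unfolding d_def by linarith+
    have "dens (edges 3 n) (\<lambda>E. \<not> weakly_weighted E 2)
        \<le> (real n)\<^sup>2 * exp (- (real d)\<^sup>2 / 512) + 16 * (real d)\<^sup>2 / real n"
      by (rule dens_not_weakly_weighted_2_le[OF elim d(3)])
    also have "\<dots> \<le> (real n)\<^sup>2 * exp (- (real n powr (1 / 4))\<^sup>2 / 512) + 16 * (2 * real n powr (1 / 4))\<^sup>2 / real n"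
      using d 1 by (intro add_mono mult_left_mono divide_right_mono power_mono)
                   (auto intro!: power_mono)
    finally show ?case .
  qed
  show "(\<lambda>n. (real n)\<^sup>2 * exp (- (real n powr (1 / 4))\<^sup>2 / 512)
      + 16 * (2 * real n powr (1 / 4))\<^sup>2 / real n) \<longlonglongrightarrow> 0"
    by real_asymp
qed simp

section \<open>Edges whose vertices have equal degrees\<close>

abbreviation degree :: "nat set set \<Rightarrow> nat \<Rightarrow> nat" where
  "degree E \<equiv> induced_colour E (\<lambda>_. 1)"

lemma degree_eq_card: "degree E v = card {e \<in> E. v \<in> e}"
  by (simp add: induced_colour_def)

text \<open>First moment bound for edge-free vertex sets: all \<open>m choose 3\<close> triples
  inside \<open>W\<close> must be absent, and there are at most \<open>n ^ m\<close> choices of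
  \<open>W\<close>.\<close>

lemma dens_sparse_subset_le:
  assumes X: "finite X" and A: "finite A" "card A \<le> n" and sub: "\<And>e. e \<subseteq> A \<Longrightarrow> card e = 3 \<Longrightarrow> e \<in> X"
  shows "dens X (\<lambda>F. \<exists>W\<in>{W. W \<subseteq> A \<and> card W = m}. \<forall>e\<in>F. \<not> e \<subseteq> W) \<le> real n ^ m / 2 ^ (m choose 3)"
proof -
  have fin: "finite {W. W \<subseteq> A \<and> card W = m}"
    using A by (auto intro: finite_subset[of _ "Pow A"])
  have "dens X (\<lambda>F. \<exists>W\<in>{W. W \<subseteq> A \<and> card W = m}. \<forall>e\<in>F. \<not> e \<subseteq> W)
      \<le> card {W. W \<subseteq> A \<and> card W = m} * (1 / 2 ^ (m choose 3))"
  proof (rule dens_Ex[OF fin])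
    fix W assume W: "W \<in> {W. W \<subseteq> A \<and> card W = m}"
    define Z where "Z = {e. e \<subseteq> W \<and> card e = 3}"
    have "finite W" using W finite_subset[of W A] A by simp
    then have cZ: "card Z = m choose 3"
      unfolding Z_def using n_subsets[of W 3] W by simp
    have "Z \<subseteq> X" using W sub by (auto simp: Z_def)
    have "dens X (\<lambda>F. \<forall>e\<in>F. \<not> e \<subseteq> W) \<le> dens X (\<lambda>F. F \<inter> Z = {})"
      by (rule dens_mono) (auto simp: Z_def)
    also have "\<dots> = 1 / 2 ^ (m choose 3)"
      using dens_disjoint[OF X \<open>Z \<subseteq> X\<close>] cZ by simp
    finally show "dens X (\<lambda>F. \<forall>e\<in>F. \<not> e \<subseteq> W) \<le> 1 / 2 ^ (m choose 3)" .
  qed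
  also have "\<dots> \<le> real n ^ m * (1 / 2 ^ (m choose 3))"
  proof (rule mult_right_mono)
    have "card {W. W \<subseteq> A \<and> card W = m} = card A choose m"
      using n_subsets[OF A(1)] by simp
    also have "\<dots> \<le> card A ^ m"
      by (cases "m \<le> card A") (simp_all add: binomial_le_pow binomial_eq_0)
    also have "\<dots> \<le> n ^ m" using A by (intro power_mono) auto
    finally show "real (card {W. W \<subseteq> A \<and> card W = m}) \<le> real n ^ m"
      by (metis of_nat_le_iff of_nat_power)
  qed simp
  finally show ?thesis by simp
qed

text \<open>Chernoff's bound for the indicator of \<open>v \<in> e\<close> gives the upper tail and,
  for its negative, the lower tail.\<close>

lemma dens_degree_deviation_le:
  assumes X: "finite X" and n: "0 < n" "card {e \<in> X. v \<in> e} \<le> n\<^sup>2" and L: "0 \<le> L"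
  shows "dens X (\<lambda>F. L * real n < \<bar>real (degree F v) - real (card {e \<in> X. v \<in> e}) / 2\<bar>) \<le> 2 * exp (- 2 * L\<^sup>2)"
proof -
  define \<mu> where "\<mu> = real (card {e \<in> X. v \<in> e}) / 2"
  have sum: "(\<Sum>e\<in>F. of_bool (v \<in> e)) = real (degree F v)" if "F \<subseteq> X" for F
    unfolding degree_eq_card using finite_subset[OF that X] by (simp add: sum_of_bool_eq Int_def)
  have sumX: "(\<Sum>e\<in>X. of_bool (v \<in> e)) = 2 * \<mu>"
    using sum[of X] unfolding degree_eq_card by (simp add: \<mu>_def)
  have Q: "(\<Sum>e\<in>X. (of_bool (v \<in> e))\<^sup>2) \<le> (real n)\<^sup>2"
  proof -
    have "(\<Sum>e\<in>X. (of_bool (v \<in> e))\<^sup>2) = (\<Sum>e\<in>X. of_bool (v \<in> e) :: real)"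
      by (rule sum.cong) auto
    also have "\<dots> = real (card {e \<in> X. v \<in> e})" using sumX by (simp add: \<mu>_def)
    also have "\<dots> \<le> real (n\<^sup>2)" using n(2) by (simp only: of_nat_le_iff)
    finally show ?thesis by simp
  qed
  have exponent: "- 2 * (L * real n)\<^sup>2 / (real n)\<^sup>2 = - 2 * L\<^sup>2"
    using n(1) by (simp add: power_mult_distrib)
  have up: "dens X (\<lambda>F. (\<Sum>e\<in>X. of_bool (v \<in> e)) / 2 + L * real n \<le> (\<Sum>e\<in>F. of_bool (v \<in> e)))
      \<le> exp (- 2 * (L * real n)\<^sup>2 / (real n)\<^sup>2)"
    by (rule chernoff[OF X Q]) (use n L in auto)
  have down: "dens X (\<lambda>F. (\<Sum>e\<in>X. - of_bool (v \<in> e)) / 2 + L * real n \<le> (\<Sum>e\<in>F. - of_bool (v \<in> e)))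
      \<le> exp (- 2 * (L * real n)\<^sup>2 / (real n)\<^sup>2)"
    by (rule chernoff[OF X]) (use Q n L in auto)
  have "dens X (\<lambda>F. L * real n < \<bar>real (degree F v) - \<mu>\<bar>)
      \<le> dens X (\<lambda>F. (\<Sum>e\<in>X. of_bool (v \<in> e)) / 2 + L * real n \<le> (\<Sum>e\<in>F. of_bool (v \<in> e))
          \<or> (\<Sum>e\<in>X. - of_bool (v \<in> e)) / 2 + L * real n \<le> (\<Sum>e\<in>F. - of_bool (v \<in> e)))"
  proof (rule dens_mono)
    fix F assume F: "F \<subseteq> X" "L * real n < \<bar>real (degree F v) - \<mu>\<bar>"
    show "(\<Sum>e\<in>X. of_bool (v \<in> e)) / 2 + L * real n \<le> (\<Sum>e\<in>F. of_bool (v \<in> e))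
        \<or> (\<Sum>e\<in>X. - of_bool (v \<in> e)) / 2 + L * real n \<le> (\<Sum>e\<in>F. - of_bool (v \<in> e))"
      unfolding sum_negf sum[OF F(1)] sumX using F(2) by linarith
  qed
  also note dens_disj
  also note add_mono[OF up down]
  finally show ?thesis unfolding exponent \<mu>_def by simp
qed

text \<open>Vertices are grouped by \<open>d v div K\<close>. Values in an interval of length
  \<open>2 * r\<close> meet at most \<open>2 * r / K + 2\<close> groups, so some group has at least
  \<open>m\<close> members, and within a group the values differ by less than
  \<open>K\<close>.\<close>

lemma pigeonhole_div:
  fixes d :: "'a \<Rightarrow> nat"
  assumes G: "finite G" "G \<noteq> {}" and K: "0 < K"
    and range: "\<And>v. v \<in> G \<Longrightarrow> \<bar>real (d v) - \<mu>\<bar> \<le> r"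
    and big: "real m * (2 * r / real K + 2) < real (card G)"
  shows "\<exists>W \<subseteq> G. card W = m \<and> (\<forall>u\<in>W. \<forall>v\<in>W. d u \<le> d v + K)"
proof -
  define g where "g v = d v div K" for v
  have "\<exists>q. m \<le> card {v \<in> G. g v = q}"
  proof (rule ccontr)
    assume "\<not> ?thesis"
    then have small: "card {v \<in> G. g v = q} \<le> m" for q
      by (meson nat_le_linear not_le)
    have "G = (\<Union>q\<in>g ` G. {v \<in> G. g v = q})" by blast
    then have "card G \<le> (\<Sum>q\<in>g ` G. card {v \<in> G. g v = q})"
      using card_UN_le[of "g ` G" "\<lambda>q. {v \<in> G. g v = q}"] G by simp
    also have "\<dots> \<le> (\<Sum>q\<in>g ` G. m)" by (intro sum_mono small)
    finally have 1: "card G \<le> m * card (g ` G)" by (simp add: mult.commute)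
    let ?a = "Min (g ` G)" and ?b = "Max (g ` G)"
    have ab: "?a \<in> g ` G" "?b \<in> g ` G" using G by (intro Min_in Max_in; simp)+
    then obtain u v where uv: "u \<in> G" "?a = g u" "v \<in> G" "?b = g v" by blast
    have "g ` G \<subseteq> {?a..?b}" using G by auto
    then have "card (g ` G) \<le> card {?a..?b}" by (intro card_mono) auto
    then have "card (g ` G) \<le> ?b + 1 - ?a" by simp
    moreover have "?a \<le> ?b" using G by auto
    ultimately have "real (card (g ` G)) \<le> real ?b - real ?a + 1" by linarith
    also have "\<dots> \<le> 2 * r / real K + 2"
    proof -
      have "real ?b * real K \<le> real (d v)"
        unfolding uv g_def by (metis of_nat_le_iff of_nat_mult div_times_less_eq_dividend)
      moreover have "real (d u) \<le> real ?a * real K + real K"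
      proof -
        have "d u \<le> (d u div K) * K + K"
          using mod_less_divisor[OF K, of "d u"] div_mult_mod_eq[of "d u" K] by linarith
        then show ?thesis
          unfolding uv g_def by (metis of_nat_le_iff of_nat_mult of_nat_add)
      qed
      moreover have "real (d v) - real (d u) \<le> 2 * r"
        using range[OF uv(1)] range[OF uv(3)] by linarith
      ultimately have "(real ?b - real ?a) * real K \<le> 2 * r + real K"
        by (simp add: algebra_simps)
      then have "real ?b - real ?a \<le> (2 * r + real K) / real K"
        using K by (simp add: pos_le_divide_eq)
      then show ?thesis using K by (simp add: add_divide_distrib)
    qed
    finally have "real m * real (card (g ` G)) \<le> real m * (2 * r / real K + 2)"
      by (rule mult_left_mono) simp
    moreover have "real (card G) \<le> real m * real (card (g ` G))"
      using 1 by (metis of_nat_le_iff of_nat_mult)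
    ultimately show False using big by linarith
  qed
  then obtain q W where W: "W \<subseteq> {v \<in> G. g v = q}" "card W = m"
    using obtain_subset_with_card_n by metis
  have "d u \<le> d v + K" if "u \<in> W" "v \<in> W" for u v
  proof -
    have "d u div K = d v div K" using that W by (auto simp: g_def)
    then have "d u = d v div K * K + d u mod K" using div_mult_mod_eq[of "d u" K] by simp
    then show ?thesis
      using mod_less_divisor[OF K, of "d u"] div_times_less_eq_dividend[of "d v" K] by linarith
  qed
  then show ?thesis using W by blast
qed

text \<open>Greedy selection. While fewer than \<open>n / 24\<close> triples are chosen, they cover
  fewer than \<open>n / 8\<close> vertices, and at most \<open>n / 4\<close> are atypical, so at
  least \<open>n / 2\<close> typical vertices of \<open>A\<close> are free.
  \<open>pigeonhole_div\<close> finds \<open>m\<close> of them with nearly equal values, and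
  \<open>dense\<close> supplies an edge of \<open>F\<close> among these.\<close>

lemma disjoint_balanced_triples:
  fixes F :: "'a set set" and d :: "'a \<Rightarrow> nat"
  assumes A: "finite A" "7 * n \<le> 8 * card A" and K: "0 < K"
    and F: "\<And>e. e \<in> F \<Longrightarrow> card e = 3"
    and dense: "\<And>W. W \<subseteq> A \<Longrightarrow> card W = m \<Longrightarrow> \<exists>e\<in>F. e \<subseteq> W"
    and conc: "real (card {v \<in> A. r < \<bar>real (d v) - \<mu>\<bar>}) \<le> real n / 4"
    and big: "real m * (2 * r / real K + 2) < real n / 2"
  shows "\<exists>\<T>\<subseteq>F. finite \<T> \<and> n \<le> 24 * card \<T> \<and> disjoint \<T> \<and>
    (\<forall>T\<in>\<T>. T \<subseteq> A \<and> (\<forall>u\<in>T. \<forall>v\<in>T. d u \<le> d v + K))"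
proof -
  let ?ok = "\<lambda>\<T>. \<T> \<subseteq> F \<and> finite \<T> \<and> disjoint \<T> \<and> (\<forall>T\<in>\<T>. T \<subseteq> A \<and> (\<forall>u\<in>T. \<forall>v\<in>T. d u \<le> d v + K))"
  \<comment> \<open>The bound admits \<open>k\<close> up to \<open>n / 24\<close> rounded up, and in
    the induction step it turns into \<open>24 * k < n\<close> for the predecessor.\<close>
  have "\<exists>\<T>. ?ok \<T> \<and> card \<T> = k" if "24 * k < n + 24" for k
    using that
  proof (induction k)
    case 0
    show ?case by (rule exI[of _ "{}"]) simp
  next
    case (Suc k)
    then obtain \<T> where \<T>: "?ok \<T>" "card \<T> = k" by auto
    have kn: "24 * k < n" using Suc.prems by simp
    define G where "G = {v \<in> A. \<bar>real (d v) - \<mu>\<bar> \<le> r} - \<Union>\<T>"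
    have fG: "finite G" using A by (simp add: G_def)
    have "card (\<Union>\<T>) \<le> (\<Sum>T\<in>\<T>. card T)" by (rule card_Union_le_sum_card)
    also have "\<dots> = (\<Sum>T\<in>\<T>. 3)" using \<T> F by (intro sum.cong) auto
    finally have "card (\<Union>\<T>) \<le> 3 * k" using \<T> by simp
    moreover define Bad where "Bad = {v \<in> A. r < \<bar>real (d v) - \<mu>\<bar>}"
    have "A \<subseteq> Bad \<union> \<Union>\<T> \<union> G" by (auto simp: G_def Bad_def)
    then have "card A \<le> card (Bad \<union> \<Union>\<T> \<union> G)"
      using \<T> A fG finite_subset[of _ A] by (intro card_mono) (auto simp: Bad_def)
    then have "card A \<le> card Bad + card (\<Union>\<T>) + card G"
      using card_Un_le[of "Bad \<union> \<Union>\<T>" G]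
        card_Un_le[of "Bad" "\<Union>\<T>"] by linarith
    ultimately have "7 * n \<le> 8 * card Bad + n + 8 * card G"
      using A(2) kn by linarith
    then have "real (7 * n) \<le> real (8 * card Bad + n + 8 * card G)"
      by (simp only: of_nat_le_iff)
    then have cG: "real n / 2 \<le> real (card G)"
      using conc by (simp add: Bad_def)
    have "n > 0" using Suc.prems by simp
    then have "G \<noteq> {}" using cG by auto
    moreover have "real m * (2 * r / real K + 2) < real (card G)" using cG big by linarith
    ultimately have "\<exists>W\<subseteq>G. card W = m \<and> (\<forall>u\<in>W. \<forall>v\<in>W. d u \<le> d v + K)"
      by (intro pigeonhole_div[OF fG _ K, of _ \<mu> r]) (auto simp: G_def)
    then obtain W where W: "W \<subseteq> G" "card W = m" "\<forall>u\<in>W. \<forall>v\<in>W. d u \<le> d v + K"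
      by blast
    have "W \<subseteq> A" using W by (auto simp: G_def)
    then obtain e where e: "e \<in> F" "e \<subseteq> W" using dense W by blast
    have "e \<inter> \<Union>\<T> = {}" using e W by (auto simp: G_def)
    moreover have "e \<noteq> {}" using F e by fastforce
    ultimately have new: "e \<notin> \<T>" "\<And>T. T \<in> \<T> \<Longrightarrow> disjnt e T" by (auto simp: disjnt_def)
    moreover have "e \<subseteq> A" "\<forall>u\<in>e. \<forall>v\<in>e. d u \<le> d v + K"
      using e(2) W(1,3) \<open>W \<subseteq> A\<close> by blast+
    moreover have "disjoint (insert e \<T>)"
      using \<T> new by (auto simp: pairwise_insert disjnt_sym)
    ultimately have "?ok (insert e \<T>)" using \<T>(1) e(1) by simp
    moreover have "card (insert e \<T>) = Suc k" using new \<T> by simp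
    ultimately show ?case by blast
  qed
  note ex = this
  have k: "24 * ((n + 23) div 24) < n + 24" by linarith
  obtain \<T> where \<T>: "?ok \<T> \<and> card \<T> = (n + 23) div 24"
    using ex[OF k] by (rule exE)
  then have "n \<le> 24 * card \<T>" by linarith
  then show ?thesis using \<T> by (intro exI[of _ \<T>]) simp
qed

text \<open>A reserved edge at \<open>v\<close> changes no degree in \<open>A\<close> except that of
  \<open>v\<close>. Degrees within a triple differ by at most \<open>K\<close>, so some choice among
  its \<open>3 * K\<close> reserved edges equalises them, and this choice has probability
  \<open>1 / 2 ^ (3 * K)\<close>. Disjoint triples have disjoint reserved edges and are therefore
  independent.\<close>

lemma dens_no_equalised_triple_le:
  fixes R :: "nat \<Rightarrow> nat set set"
  assumes A: "finite A" and F: "finite F" "F \<inter> (\<Union>v\<in>A. R v) = {}"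
    and R: "\<And>v. v \<in> A \<Longrightarrow> finite (R v)" "\<And>v. v \<in> A \<Longrightarrow> card (R v) = K"
      "\<And>v e u. v \<in> A \<Longrightarrow> e \<in> R v \<Longrightarrow> u \<in> A \<Longrightarrow> u \<in> e \<longleftrightarrow> u = v"
    and \<T>: "finite \<T>" "disjoint \<T>" "\<And>T. T \<in> \<T> \<Longrightarrow> T \<subseteq> A" "\<And>T. T \<in> \<T> \<Longrightarrow> card T = 3"
      "\<And>T u v. T \<in> \<T> \<Longrightarrow> u \<in> T \<Longrightarrow> v \<in> T \<Longrightarrow> degree F u \<le> degree F v + K"
  shows "dens (\<Union>v\<in>A. R v) (\<lambda>G. \<forall>T\<in>\<T>. \<exists>u\<in>T. \<exists>v\<in>T. degree (F \<union> G) u \<noteq> degree (F \<union> G) v)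
    \<le> (1 - 1 / 2 ^ (3 * K)) ^ card \<T>"
proof -
  define U where "U = (\<Union>v\<in>A. R v)"
  define B where "B T = (\<Union>v\<in>T. R v)" for T
  \<comment> \<open>Equality of the final degrees expressed through the reserved edges at
    \<open>T\<close> alone, so that the events for different triples factorise.\<close>
  define eq where "eq T H \<longleftrightarrow> (\<forall>u\<in>T. \<forall>v\<in>T. degree F u + card (H \<inter> R u) = degree F v + card (H \<inter> R v))" for T H
  have fU: "finite U" using A R by (simp add: U_def)
  have disj: "R u \<inter> R v = {}" if "u \<in> A" "v \<in> A" "u \<noteq> v" for u v
    using that R(3) by blast
  have BU: "B T \<subseteq> U" if "T \<in> \<T>" for T using \<T>(3)[OF that] by (auto simp: B_def U_def)
  have fB: "finite (B T)" if "T \<in> \<T>" for T using finite_subset[OF BU[OF that] fU] .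
  have fT: "finite T" if "T \<in> \<T>" for T using finite_subset[OF \<T>(3)[OF that] A] .
  have disjB: "disjoint_family_on B \<T>"
    unfolding disjoint_family_on_def
  proof (intro ballI impI)
    fix S T assume "S \<in> \<T>" "T \<in> \<T>" "S \<noteq> T"
    then have "S \<inter> T = {}" "S \<subseteq> A" "T \<subseteq> A" using \<T>(2,3) by (auto simp: disjoint_def)
    then show "B S \<inter> B T = {}" unfolding B_def using disj by blast
  qed
  have deg: "degree (F \<union> G) v = degree F v + card (G \<inter> R v)" if "G \<subseteq> U" "v \<in> A" for G v
  proof -
    have "{e \<in> G. v \<in> e} = G \<inter> R v" using that R(3) unfolding U_def by blast
    then have "degree G v = card (G \<inter> R v)" by (simp only: degree_eq_card)
    moreover have "F \<inter> G = {}" using F(2) that(1) unfolding U_def by blast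
    ultimately show ?thesis
      using induced_colour_Un[OF F(1) finite_subset[OF that(1) fU], of "\<lambda>_. 1" v] by simp
  qed
  have single: "avg (B T) (\<lambda>H. of_bool (\<not> eq T H)) \<le> 1 - 1 / 2 ^ (3 * K)" if T: "T \<in> \<T>" for T
  proof -
    define M where "M = Max (degree F ` T)"
    have "T \<noteq> {}" using \<T>(4)[OF T] by auto
    then have "M \<in> degree F ` T" unfolding M_def using fT[OF T] by (intro Max_in) auto
    then obtain w where w: "w \<in> T" "M = degree F w" by blast
    have le: "degree F v \<le> M" if "v \<in> T" for v
      unfolding M_def using fT[OF T] that by auto
    \<comment> \<open>Every vertex of \<open>T\<close> is to be raised to the largest degree in
      \<open>T\<close>; the deficit fits into its \<open>K\<close> reserved edges.\<close>
    have "\<exists>H\<subseteq>R v. card H = M - degree F v" if "v \<in> T" for v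
    proof -
      have "M - degree F v \<le> card (R v)"
        using \<T>(5)[OF T w(1) that] w R(2) \<T>(3)[OF T] that by auto
      then show ?thesis using obtain_subset_with_card_n by metis
    qed
    then obtain h where h: "\<And>v. v \<in> T \<Longrightarrow> h v \<subseteq> R v" "\<And>v. v \<in> T \<Longrightarrow> card (h v) = M - degree F v"
      by metis
    define H0 where "H0 = (\<Union>v\<in>T. h v)"
    have "H0 \<inter> R v = h v" if "v \<in> T" for v
      unfolding H0_def using h(1) that disj \<T>(3)[OF T] by blast
    then have "eq T H0" unfolding eq_def using h(2) le by simp
    have "H0 \<subseteq> B T" unfolding H0_def B_def using h(1) by blast
    have "card (B T) = (\<Sum>v\<in>T. card (R v))"
      unfolding B_def using fT[OF T] R(1) disj \<T>(3)[OF T] by (intro card_UN_disjoint) blast+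
    also have "\<dots> = 3 * K" using R(2) \<T>(3)[OF T] \<T>(4)[OF T] by (simp add: subset_iff)
    finally have cB: "card (B T) = 3 * K" .
    \<comment> \<open>Only the single outcome \<open>H0\<close> is counted as a success.\<close>
    have "avg (B T) (\<lambda>H. of_bool (\<not> eq T H)) \<le> avg (B T) (\<lambda>H. 1 + (-1) * of_bool (H = H0))"
      by (rule avg_mono) (use \<open>eq T H0\<close> in auto)
    also have "\<dots> = 1 - 1 / 2 ^ (3 * K)"
      using avg_eq_single[OF fB[OF T] \<open>H0 \<subseteq> B T\<close>] fB[OF T]
      by (simp only: avg_add avg_cmult avg_const cB)
    finally show ?thesis .
  qed
  have "dens U (\<lambda>G. \<forall>T\<in>\<T>. \<exists>u\<in>T. \<exists>v\<in>T. degree (F \<union> G) u \<noteq> degree (F \<union> G) v)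
      \<le> avg U (\<lambda>G. \<Prod>T\<in>\<T>. of_bool (\<not> eq T (G \<inter> B T)))"
    unfolding dens_def
  proof (rule avg_mono)
    fix G assume G: "G \<subseteq> U"
    have "\<not> eq T (G \<inter> B T)"
      if bad: "\<forall>T\<in>\<T>. \<exists>u\<in>T. \<exists>v\<in>T. degree (F \<union> G) u \<noteq> degree (F \<union> G) v" and T: "T \<in> \<T>" for T
    proof
      assume "eq T (G \<inter> B T)"
      moreover have "G \<inter> B T \<inter> R v = G \<inter> R v" if "v \<in> T" for v
        using that by (auto simp: B_def)
      ultimately have "degree (F \<union> G) u = degree (F \<union> G) v" if "u \<in> T" "v \<in> T" for u v
        using that deg[OF G] \<T>(3)[OF T] unfolding eq_def by (metis subsetD)
      then show False using bad T by blast
    qed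
    then show "of_bool (\<forall>T\<in>\<T>. \<exists>u\<in>T. \<exists>v\<in>T. degree (F \<union> G) u \<noteq> degree (F \<union> G) v)
        \<le> (\<Prod>T\<in>\<T>. of_bool (\<not> eq T (G \<inter> B T)) :: real)"
      by (cases "\<forall>T\<in>\<T>. \<exists>u\<in>T. \<exists>v\<in>T. degree (F \<union> G) u \<noteq> degree (F \<union> G) v")
        (simp_all only: of_bool_eq, simp_all add: prod_nonneg)
  qed
  also have "\<dots> = (\<Prod>T\<in>\<T>. avg (B T) (\<lambda>H. of_bool (\<not> eq T H)))"
    by (rule avg_prod_subset[OF fU \<T>(1) BU disjB])
  also have "\<dots> \<le> (\<Prod>T\<in>\<T>. 1 - 1 / 2 ^ (3 * K))"
    using single by (intro prod_mono conjI avg_nonneg) auto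
  finally show ?thesis by (simp add: U_def)
qed

section \<open>Reserved edges and the choice of parameters\<close>

lemma card_edges_containing:
  assumes "v \<in> {1..n}"
  shows "card {e \<in> edges 3 n. v \<in> e} = (n - 1) choose 2"
proof -
  let ?Y = "{y. y \<subseteq> {1..n} - {v} \<and> card y = 2}"
  have "{e \<in> edges 3 n. v \<in> e} = insert v ` ?Y"
  proof (intro equalityI subsetI)
    fix e assume e: "e \<in> {e \<in> edges 3 n. v \<in> e}"
    then have "e = insert v (e - {v})" "e - {v} \<in> ?Y" by (auto simp: edges_def)
    then show "e \<in> insert v ` ?Y" by blast
  next
    fix e assume "e \<in> insert v ` ?Y"
    then obtain y where y: "e = insert v y" "y \<subseteq> {1..n} - {v}" "card y = 2" by blast
    then have "finite y" "v \<notin> y" by (auto intro: finite_subset)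
    then have "card e = 3" using y by simp
    then show "e \<in> {e \<in> edges 3 n. v \<in> e}" using y assms by (auto simp: edges_def)
  qed
  then have "card {e \<in> edges 3 n. v \<in> e} = card ?Y"
    using card_insert_image[of v "{1..n} - {v}" "\<lambda>y. card y = 2"] by simp
  then show ?thesis
    using n_subsets[of "{1..n} - {v}" 2] assms by simp
qed

text \<open>The last \<open>K + 1\<close> vertices serve as helpers. Joining \<open>v\<close> to
  \<open>n\<close> and one other helper gives \<open>K\<close> edges that meet
  \<open>{1..<n - K}\<close> only in \<open>v\<close>, so different vertices below
  \<open>n - K\<close> own different edges.\<close>

definition reserve :: "nat \<Rightarrow> nat \<Rightarrow> nat \<Rightarrow> nat set set" where
  "reserve n K v = (\<lambda>b. {v, b, n}) ` {n - K..<n}"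

lemma reserve_props:
  assumes "v \<in> {1..<n - K}"
  shows "finite (reserve n K v)" "card (reserve n K v) = K" "reserve n K v \<subseteq> edges 3 n"
    "\<And>e u. e \<in> reserve n K v \<Longrightarrow> u \<in> {1..<n - K} \<Longrightarrow> u \<in> e \<longleftrightarrow> u = v"
proof -
  show "finite (reserve n K v)" by (simp add: reserve_def)
  have "inj_on (\<lambda>b. {v, b, n}) {n - K..<n}"
    using assms by (auto simp: inj_on_def doubleton_eq_iff insert_eq_iff)
  then show "card (reserve n K v) = K"
    unfolding reserve_def using assms by (subst card_image) auto
  show "reserve n K v \<subseteq> edges 3 n" using assms by (auto simp: reserve_def edges_def)
  show "u \<in> e \<longleftrightarrow> u = v" if "e \<in> reserve n K v" "u \<in> {1..<n - K}" for e u
    using that assms by (auto simp: reserve_def)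
qed

text \<open>The unreserved edges \<open>F\<close> are revealed first. The three terms bound, in
  order, the chance that some \<open>m\<close> vertices of \<open>A\<close> span no edge of
  \<open>F\<close>, the chance that more than \<open>n / 4\<close> degrees deviate by more than
  \<open>L * n\<close>, and, when neither happens, the chance that the reserved edges equalise none
  of at least \<open>n / 24\<close> disjoint triples.\<close>

lemma dens_weakly_weighted_1_le:
  assumes K: "0 < K" "8 * (K + 1) \<le> n" and L: "0 \<le> L"
    and big: "real m * (2 * (L * real n) / real K + 2) < real n / 2"
  shows "dens (edges 3 n) (\<lambda>E. weakly_weighted E 1)
    \<le> real n ^ m / 2 ^ (m choose 3) + 8 * exp (- 2 * L\<^sup>2) + exp (- real n / (24 * 2 ^ (3 * K)))"
proof -
  define A where "A = {1..<n - K}"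
  define R where "R = (\<Union>v\<in>A. reserve n K v)"
  define Y where "Y = edges 3 n - R"
  \<comment> \<open>The expected degree in \<open>F\<close>: a vertex of \<open>A\<close> lies in
    \<open>(n - 1) choose 2\<close> triples, exactly \<open>K\<close> of which are reserved.\<close>
  define \<mu> where "\<mu> = real (((n - 1) choose 2) - K) / 2"
  define sparse where "sparse F \<longleftrightarrow> (\<exists>W\<in>{W. W \<subseteq> A \<and> card W = m}. \<forall>e\<in>F. \<not> e \<subseteq> W)" for F :: "nat set set"
  define spread where "spread F \<longleftrightarrow> real n / 4 < real (card {v \<in> A. L * real n < \<bar>real (degree F v) - \<mu>\<bar>})" for F
  define c where "c = exp (- real n / (24 * 2 ^ (3 * K)))"
  note props = reserve_props[of _ n K, folded A_def]
  have n: "0 < n" using K by simp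
  \<comment> \<open>The assumption \<open>8 * (K + 1) <= n\<close> says that
    \<open>card A = n - K - 1\<close> is at least \<open>7 * n / 8\<close>, the size that the greedy
    selection requires.\<close>
  have fA: "finite A" "card A \<le> n" "7 * n \<le> 8 * card A" "A \<subseteq> {1..n}" using K by (auto simp: A_def)
  have RX: "R \<subseteq> edges 3 n" using props(3) by (auto simp: R_def)
  have fR: "finite R" "finite Y" using finite_subset[OF RX] by (auto simp: Y_def)
  have sparse: "dens Y sparse \<le> real n ^ m / 2 ^ (m choose 3)"
    unfolding sparse_def
  proof (rule dens_sparse_subset_le[OF fR(2) fA(1,2)])
    fix e assume e: "e \<subseteq> A" "card e = 3"
    have "e \<notin> R"
    proof
      assume "e \<in> R"
      then have "n \<in> e" by (auto simp: R_def reserve_def)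
      then have "n \<in> A" using e by blast
      then show False by (auto simp: A_def)
    qed
    then show "e \<in> Y" using e fA(4) by (auto simp: Y_def edges_def)
  qed
  have spread: "dens Y spread \<le> 8 * exp (- 2 * L\<^sup>2)"
  proof -
    \<comment> \<open>Markov's inequality at threshold \<open>n / 4\<close> turns the factor 2 of
      the two-sided tail into 8.\<close>
    have "dens Y spread \<le> real (card A) * (2 * exp (- 2 * L\<^sup>2)) / (real n / 4)"
      unfolding spread_def
    proof (rule dens_many_le[OF fA(1)])
      fix v assume v: "v \<in> A"
      have "e \<in> R \<longleftrightarrow> e \<in> reserve n K v" if "v \<in> e" for e
        using v props(4)[of _ e v] that unfolding R_def by blast
      then have "{e \<in> Y. v \<in> e} = {e \<in> edges 3 n. v \<in> e} - reserve n K v"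
        unfolding Y_def by blast
      moreover have "reserve n K v \<subseteq> {e \<in> edges 3 n. v \<in> e}"
        using v props(3,4) by blast
      ultimately have card: "card {e \<in> Y. v \<in> e} = ((n - 1) choose 2) - K"
        using v props(1,2) card_edges_containing[of v n] fA(4) by (auto simp: card_Diff_subset)
      have "((n - 1) choose 2) - K \<le> (n - 1) * (n - 1 - 1)" by (simp add: choose_two)
      also have "\<dots> \<le> n\<^sup>2" unfolding power2_eq_square by (intro mult_mono) auto
      finally show "dens Y (\<lambda>F. L * real n < \<bar>real (degree F v) - \<mu>\<bar>) \<le> 2 * exp (- 2 * L\<^sup>2)"
        using dens_degree_deviation_le[OF fR(2) n _ L, of v] unfolding card \<mu>_def by simp
    qed (use n in simp)
    also have "\<dots> \<le> real n * (2 * exp (- 2 * L\<^sup>2)) / (real n / 4)"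
      using fA(2) by (intro divide_right_mono mult_right_mono) auto
    finally show ?thesis using n by simp
  qed
  have inner: "avg R (\<lambda>G. of_bool (weakly_weighted (F \<union> G) 1)) \<le> of_bool (sparse F) + of_bool (spread F) + c"
    if F: "F \<subseteq> Y" for F
  proof (cases "sparse F \<or> spread F")
    case True
    have "avg R (\<lambda>G. of_bool (weakly_weighted (F \<union> G) 1)) \<le> 1"
      by (rule avg_le_const[OF fR(1)]) simp
    also have "\<dots> \<le> of_bool (sparse F) + of_bool (spread F) + c"
      using True by (auto simp: c_def)
    finally show ?thesis .
  next
    case False
    have F3: "card e = 3" if "e \<in> F" for e using that F by (auto simp: Y_def edges_def)
    have "\<exists>\<T>\<subseteq>F. finite \<T> \<and> n \<le> 24 * card \<T> \<and> disjoint \<T> \<and>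
        (\<forall>T\<in>\<T>. T \<subseteq> A \<and> (\<forall>u\<in>T. \<forall>v\<in>T. degree F u \<le> degree F v + K))"
      by (rule disjoint_balanced_triples[OF fA(1,3) K(1) F3 _ _ big])
        (use False in \<open>auto simp: sparse_def spread_def not_less\<close>)
    then obtain \<T> where \<T>: "\<T> \<subseteq> F" "finite \<T>" "n \<le> 24 * card \<T>" "disjoint \<T>"
      and balanced: "\<forall>T\<in>\<T>. T \<subseteq> A \<and> (\<forall>u\<in>T. \<forall>v\<in>T. degree F u \<le> degree F v + K)"
      by (elim exE conjE)
    have "avg R (\<lambda>G. of_bool (weakly_weighted (F \<union> G) 1))
        \<le> dens R (\<lambda>G. \<forall>T\<in>\<T>. \<exists>u\<in>T. \<exists>v\<in>T. degree (F \<union> G) u \<noteq> degree (F \<union> G) v)"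
      unfolding dens_def
    proof (rule avg_mono)
      fix G
      \<comment> \<open>The chosen triples are edges of \<open>F\<close>, hence of
        \<open>F \<union> G\<close>, so one with equal degrees would be a monochromatic
        edge.\<close>
      have "\<forall>T\<in>\<T>. \<exists>u\<in>T. \<exists>v\<in>T. degree (F \<union> G) u \<noteq> degree (F \<union> G) v" if "weakly_weighted (F \<union> G) 1"
        using that not_weakly_weighted_1_iff[of "F \<union> G"] \<T>(1) by blast
      then show "of_bool (weakly_weighted (F \<union> G) 1)
          \<le> (of_bool (\<forall>T\<in>\<T>. \<exists>u\<in>T. \<exists>v\<in>T. degree (F \<union> G) u \<noteq> degree (F \<union> G) v) :: real)"
        by simp
    qed
    also have "\<dots> \<le> (1 - 1 / 2 ^ (3 * K)) ^ card \<T>"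
      unfolding R_def
    proof (rule dens_no_equalised_triple_le[OF fA(1)])
      show "finite F" using finite_subset[OF F fR(2)] .
      show "F \<inter> (\<Union>v\<in>A. reserve n K v) = {}" using F by (auto simp: Y_def R_def)
      show "card T = 3" if "T \<in> \<T>" for T using that \<T>(1) F3 by blast
      show "T \<subseteq> A" if "T \<in> \<T>" for T using that balanced by simp
      show "degree F u \<le> degree F v + K" if "T \<in> \<T>" "u \<in> T" "v \<in> T" for T u v
        using that balanced by simp
    qed (use \<T>(2,4) props in simp_all)
    also have "\<dots> \<le> exp (- (1 / 2 ^ (3 * K))) ^ card \<T>"
      using exp_ge_add_one_self[of "- (1 / 2 ^ (3 * K))"] by (intro power_mono) auto
    also have "\<dots> = exp (- (real (card \<T>) / 2 ^ (3 * K)))"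
      by (simp add: exp_of_nat_mult[symmetric])
    also have "\<dots> \<le> c"
    proof -
      have "real n \<le> real (24 * card \<T>)" using \<T>(3) by (simp only: of_nat_le_iff)
      then have "real n / 24 / 2 ^ (3 * K) \<le> real (card \<T>) / 2 ^ (3 * K)"
        by (intro divide_right_mono) auto
      then show ?thesis by (simp add: c_def)
    qed
    finally show ?thesis using False by simp
  qed
  have "dens (edges 3 n) (\<lambda>E. weakly_weighted E 1)
      = avg Y (\<lambda>F. avg R (\<lambda>G. of_bool (weakly_weighted (F \<union> G) 1)))"
    unfolding dens_def Y_def by (rule avg_split) (use RX in auto)
  also have "\<dots> \<le> avg Y (\<lambda>F. of_bool (sparse F) + of_bool (spread F) + c)"
    by (rule avg_mono) (rule inner)
  also have "\<dots> = dens Y sparse + dens Y spread + c"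
    unfolding dens_def avg_add using fR(2) by (simp add: avg_const)
  finally show ?thesis using sparse spread by (simp add: c_def)
qed

text \<open>For fixed \<open>L\<close> the deviation term stays constant in \<open>n\<close>, so
  \<open>L = l\<close> is chosen from \<open>\<epsilon>\<close> first; \<open>K\<close> and
  \<open>m\<close> then grow like \<open>log n\<close>, which makes the other two terms
  vanish.\<close>

lemma tendsto_dens_weakly_weighted_1:
  "(\<lambda>n. dens (edges 3 n) (\<lambda>E. weakly_weighted E 1)) \<longlonglongrightarrow> 0"
proof (rule tendstoI)
  fix \<epsilon> :: real assume \<epsilon>: "0 < \<epsilon>"
  \<comment> \<open>Then \<open>2 ^ (3 * K) <= sqrt n\<close>, so the equalising term is at most
    \<open>exp (- sqrt n / 24)\<close>.\<close>
  define K where "K n = nat \<lfloor>log 2 (real n) / 6\<rfloor>" for n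
  have "(\<lambda>l. 8 * exp (- 2 * (real l)\<^sup>2)) \<longlonglongrightarrow> 0" by real_asymp
  then have "\<forall>\<^sub>F l in sequentially. 8 * exp (- 2 * (real l)\<^sup>2) < \<epsilon> / 3"
    by (rule order_tendstoD) (use \<epsilon> in simp)
  then obtain l where l: "0 < l" "8 * exp (- 2 * (real l)\<^sup>2) < \<epsilon> / 3"
    using eventually_happens[OF eventually_conj[OF _ eventually_gt_at_top[of 0]]] by auto
  \<comment> \<open>Chosen so that \<open>m * (2 * l * n / K) <= n / 4\<close>, as the pigeonhole
    argument demands.\<close>
  define m where "m n = K n div (8 * l)" for n
  have K_lim: "filterlim K at_top sequentially"
    unfolding K_def by real_asymp
  have m_lim: "filterlim m at_top sequentially"
    unfolding filterlim_at_top
  proof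
    fix Z
    have "\<forall>\<^sub>F n in sequentially. Z * (8 * l) \<le> K n"
      using K_lim by (simp add: filterlim_at_top)
    then show "\<forall>\<^sub>F n in sequentially. Z \<le> m n"
      by eventually_elim (use l in \<open>simp add: m_def less_eq_div_iff_mult_less_eq\<close>)
  qed
  \<comment> \<open>From \<open>log 2 n < 6 * (K + 1) <= 48 * l * (m + 1)\<close> the binary
    logarithm of \<open>n ^ m\<close> is at most quadratic in \<open>m\<close>, while
    \<open>m choose 3\<close> is cubic.\<close>
  have "((\<lambda>m. 2 powr (48 * real l * (real m + 1) * real m - real m * (real m - 1) * (real m - 2) / 6)) \<longlongrightarrow> 0) sequentially"
    by real_asymp
  then have "((\<lambda>n. 2 powr (48 * real l * (real (m n) + 1) * real (m n)
      - real (m n) * (real (m n) - 1) * (real (m n) - 2) / 6)) \<longlongrightarrow> 0) sequentially"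
    using m_lim by (rule filterlim_compose)
  then have ev1: "\<forall>\<^sub>F n in sequentially. 2 powr (48 * real l * (real (m n) + 1) * real (m n)
      - real (m n) * (real (m n) - 1) * (real (m n) - 2) / 6) < \<epsilon> / 3"
    by (rule order_tendstoD) (use \<epsilon> in simp)
  have "(\<lambda>n. exp (- real n / (24 * sqrt (real n)))) \<longlonglongrightarrow> 0" by real_asymp
  then have ev2: "\<forall>\<^sub>F n in sequentially. exp (- real n / (24 * sqrt (real n))) < \<epsilon> / 3"
    by (rule order_tendstoD) (use \<epsilon> in simp)
  have ev3: "\<forall>\<^sub>F n in sequentially. 8 * (log 2 (real n) / 6 + 2) \<le> real n" by real_asymp
  have ev4: "\<forall>\<^sub>F n in sequentially. 1 \<le> K n" using K_lim by (simp add: filterlim_at_top)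
  have ev5: "\<forall>\<^sub>F n in sequentially. 2 \<le> m n" using m_lim by (simp add: filterlim_at_top)
  show "\<forall>\<^sub>F n in sequentially. dist (dens (edges 3 n) (\<lambda>E. weakly_weighted E 1)) 0 < \<epsilon>"
    using ev1 ev2 ev3 ev4 ev5 eventually_gt_at_top[of 0]
  proof eventually_elim
    case (elim n)
    have K_le: "real (K n) \<le> log 2 (real n) / 6" and K_gt: "log 2 (real n) / 6 < real (K n) + 1"
      using elim(4) unfolding K_def by linarith+
    have Kn: "8 * (K n + 2) \<le> n"
    proof -
      have "real (8 * (K n + 2)) \<le> real n" using elim(3) K_le by simp
      then show ?thesis by (simp only: of_nat_le_iff)
    qed
    have ml: "m n * (8 * l) \<le> K n" "K n < (m n + 1) * (8 * l)"
      using l(1) dividend_less_div_times[of "8 * l" "K n"] div_times_less_eq_dividend[of "K n" "8 * l"]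
      unfolding m_def by (simp_all only: add_mult_distrib mult_1 add.commute)
    have "real (m n) * (2 * (real l * real n) / real (K n)) \<le> real n / 4"
    proof -
      have "real (m n * (8 * l)) \<le> real (K n)" using ml(1) by (simp only: of_nat_le_iff)
      then have "real (m n) * (8 * real l) * real n \<le> real (K n) * real n"
        by (intro mult_right_mono) auto
      then show ?thesis using elim(4) by (simp add: field_simps)
    qed
    \<comment> \<open>The summand 2 in the number of groups costs \<open>2 * m\<close>, which must
      fit into the other \<open>n / 4\<close>.\<close>
    moreover have "m n \<le> K n" by (simp add: m_def)
    then have "8 * m n < n" using Kn by simp
    then have "real (m n) * 2 < real n / 4" by linarith
    ultimately have big: "real (m n) * (2 * (real l * real n) / real (K n) + 2) < real n / 2"
      by (simp add: distrib_left)
    have "dens (edges 3 n) (\<lambda>E. weakly_weighted E 1) \<le> real n ^ m n / 2 ^ (m n choose 3)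
        + 8 * exp (- 2 * (real l)\<^sup>2) + exp (- real n / (24 * 2 ^ (3 * K n)))"
      by (rule dens_weakly_weighted_1_le[OF _ _ _ big]) (use elim(4) Kn in auto)
    also have "real n ^ m n / 2 ^ (m n choose 3)
        \<le> 2 powr (48 * real l * (real (m n) + 1) * real (m n)
          - real (m n) * (real (m n) - 1) * (real (m n) - 2) / 6)"
    proof -
      have "real n = 2 powr log 2 (real n)" using elim(6) by simp
      also have "\<dots> \<le> 2 powr (48 * real l * (real (m n) + 1))"
      proof -
        have "K n + 1 \<le> (m n + 1) * (8 * l)" using ml(2) by simp
        then have "real (K n + 1) \<le> real ((m n + 1) * (8 * l))" by (simp only: of_nat_le_iff)
        then show ?thesis using K_gt by (simp add: algebra_simps)
      qed
      finally have "real n ^ m n \<le> (2 powr (48 * real l * (real (m n) + 1))) ^ m n"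
        by (rule power_mono) simp
      also have "\<dots> = 2 powr (48 * real l * (real (m n) + 1) * real (m n))"
        by (simp add: powr_powr powr_realpow[symmetric])
      finally have num: "real n ^ m n \<le> 2 powr (48 * real l * (real (m n) + 1) * real (m n))" .
      have "real (m n choose 3) = real (m n) * (real (m n) - 1) * (real (m n) - 2) / 6"
        using elim(5) by (simp add: binomial_gbinomial gbinomial_prod_rev numeral_3_eq_3 lessThan_Suc)
      then have den: "(2 :: real) ^ (m n choose 3) = 2 powr (real (m n) * (real (m n) - 1) * (real (m n) - 2) / 6)"
        by (metis powr_realpow zero_less_numeral)
      show ?thesis
        unfolding den powr_diff using num by (intro divide_right_mono) auto
    qed
    also have "exp (- real n / (24 * 2 ^ (3 * K n))) \<le> exp (- real n / (24 * sqrt (real n)))"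
    proof -
      have "(2 :: real) ^ (3 * K n) = 2 powr (3 * real (K n))"
        by (simp add: powr_realpow[symmetric])
      also have "\<dots> \<le> 2 powr (log 2 (real n) / 2)" using K_le by simp
      also have "\<dots> = (2 powr log 2 (real n)) powr (1 / 2)" by (simp add: powr_powr)
      also have "\<dots> = sqrt (real n)" using elim(6) by (simp add: powr_half_sqrt)
      finally have "24 * (2 :: real) ^ (3 * K n) \<le> 24 * sqrt (real n)" by simp
      then have "real n / (24 * sqrt (real n)) \<le> real n / (24 * 2 ^ (3 * K n))"
        using elim(6) by (intro divide_left_mono) auto
      then show ?thesis by simp
    qed
    finally show ?case
      using elim(1,2) l(2) dens_nonneg[of "edges 3 n" "\<lambda>E. weakly_weighted E 1"] by simp
  qed
qed

theorem theorem1p3: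
  shows "almost_all 3 (\<lambda>E. weakly_weighted E 2 \<and> \<not> weakly_weighted E 1)
       \<and> (\<forall>r\<ge>4. almost_all r (\<lambda>E. weakly_weighted E 1))"
proof (intro conjI allI impI)
  show "almost_all 3 (\<lambda>E. weakly_weighted E 2 \<and> \<not> weakly_weighted E 1)"
  proof (rule almost_allI, rule tendsto_sandwich[OF _ _ tendsto_const])
    show "\<forall>\<^sub>F n in sequentially. dens (edges 3 n) (\<lambda>E. \<not> (weakly_weighted E 2 \<and> \<not> weakly_weighted E 1))
        \<le> dens (edges 3 n) (\<lambda>E. \<not> weakly_weighted E 2) + dens (edges 3 n) (\<lambda>E. weakly_weighted E 1)"
      unfolding de_Morgan_conj not_not by (intro always_eventually allI dens_disj)
    show "(\<lambda>n. dens (edges 3 n) (\<lambda>E. \<not> weakly_weighted E 2) + dens (edges 3 n) (\<lambda>E. weakly_weighted E 1)) \<longlonglongrightarrow> 0"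
      using tendsto_add[OF tendsto_dens_not_weakly_weighted_2 tendsto_dens_weakly_weighted_1] by simp
  qed (simp add: dens_nonneg)
next
  fix r :: nat assume "4 \<le> r"
  then show "almost_all r (\<lambda>E. weakly_weighted E 1)" by (rule almost_all_weakly_weighted_1)
qed

end
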